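(* Let $E$ be a finite directed graph. Then the Weyl group $\mathfrak W_E=\mathrm{Aut}(C^*(E),\mathcal D_E)/\mathrm{Aut}_{\mathcal D_E}(C^*(E))$ is countable.
   Context: A directed graph $E=(E^0,E^1,r,s)$ has vertex set $E^0$, edge set $E^1$, and range and source maps $r,s:E^1\to E^0$; it is finite if $E^0$ and $E^1$ are finite. $C^*(E)$ is the universal $C^*$-algebra generated by mutually orthogonal projections $P_v$ ($v\in E^0$) and partial isometries $S_e$ ($e\in E^1$) with $S_e^*S_e=P_{r(e)}$, $S_e^*S_f=0$ for $e\ne f$, $S_eS_e^*\le P_{s(e)}$, and $P_v=\sum_{s(e)=v}S_eS_e^*$ whenever $v$ emits finitely many and at least one edge. A path of length $k\ge1$ is $\mu=(\mu_1,\ldots,\mu_k)$ with $\mu_j\in E^1$ and $r(\mu_j)=s(\mu_{j+1})$; vertices are the paths of length $0$; put $S_\mu=S_{\mu_1}\cdots S_{\mu_k}$, $S_v=P_v$, and $P_\mu=S_\mu S_\mu^*$. $\mathcal D_E$ (the diagonal) is the $C^*$-subalgebra of $C^*(E)$ generated by all $P_\mu$. $\mathrm{Aut}_{\mathcal D_E}(C^*(E))$ is the group of automorphisms of $C^*(E)$ which fix $\mathcal D_E$ pointwise, and $\mathrm{Aut}(C^*(E),\mathcal D_E)$ is the group of automorphisms $\alpha$ of $C^*(E)$ with $\alpha(\mathcal D_E)=\mathcal D_E$; the former is a normal subgroup of the latter. *)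

theory Defs
  imports
    Complex_Main
    "HOL-Library.Poly_Mapping"
    "HOL-Library.Countable_Set"
    "HOL-Algebra.Bij"
    "HOL-Algebra.Coset"
    "Graph_Theory.Digraph"
    "Graph_Theory.Arc_Walk"
begin

section \<open>Normed *-algebras on a carrier\<close>

text \<open>A multiplicative unit is not part of the structure.\<close>

record 'a star_alg = "'a partial_object" +
  sadd :: "'a \<Rightarrow> 'a \<Rightarrow> 'a"
  szero :: 'a
  smult :: "'a \<Rightarrow> 'a \<Rightarrow> 'a"
  sscale :: "complex \<Rightarrow> 'a \<Rightarrow> 'a"
  sstar :: "'a \<Rightarrow> 'a"
  snorm :: "'a \<Rightarrow> real"

definition sdist :: "'a star_alg \<Rightarrow> 'a \<Rightarrow> 'a \<Rightarrow> real" where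
  "sdist A x y = snorm A (sadd A x (sscale A (-1) y))"

definition cstar_subalgebra :: "'a star_alg \<Rightarrow> 'a set \<Rightarrow> bool" where
  "cstar_subalgebra A B \<longleftrightarrow>
     B \<subseteq> carrier A \<and> szero A \<in> B \<and>
     (\<forall>x\<in>B. \<forall>y\<in>B. sadd A x y \<in> B \<and> smult A x y \<in> B) \<and>
     (\<forall>c. \<forall>x\<in>B. sscale A c x \<in> B) \<and>
     (\<forall>x\<in>B. sstar A x \<in> B) \<and>
     (\<forall>X a. (\<forall>n::nat. X n \<in> B) \<longrightarrow> a \<in> carrier A \<longrightarrow>
        (\<lambda>n. sdist A (X n) a) \<longlonglongrightarrow> 0 \<longrightarrow> a \<in> B)"

definition cstar_generated :: "'a star_alg \<Rightarrow> 'a set \<Rightarrow> 'a set" where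
  "cstar_generated A X = \<Inter> {B. cstar_subalgebra A B \<and> X \<subseteq> B}"

text \<open>Automorphisms are *-automorphisms. As usual for \<^const>\<open>BijGroup\<close>, they are made
  extensional so that each one is a unique function.\<close>

definition star_auto :: "'a star_alg \<Rightarrow> ('a \<Rightarrow> 'a) set" where
  "star_auto A = {f \<in> Bij (carrier A).
     (\<forall>x\<in>carrier A. \<forall>y\<in>carrier A.
        f (sadd A x y) = sadd A (f x) (f y) \<and> f (smult A x y) = smult A (f x) (f y)) \<and>
     (\<forall>c. \<forall>x\<in>carrier A. f (sscale A c x) = sscale A c (f x)) \<and>
     (\<forall>x\<in>carrier A. f (sstar A x) = sstar A (f x))}"

definition Aut_preserving :: "'a star_alg \<Rightarrow> 'a set \<Rightarrow> ('a \<Rightarrow> 'a) monoid" where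
  "Aut_preserving A D = (BijGroup (carrier A))\<lparr>carrier := {f \<in> star_auto A. f ` D = D}\<rparr>"

definition Aut_fixing :: "'a star_alg \<Rightarrow> 'a set \<Rightarrow> ('a \<Rightarrow> 'a) set" where
  "Aut_fixing A D = {f \<in> star_auto A. \<forall>d\<in>D. f d = d}"


section \<open>Free *-algebras\<close>

text \<open>A letter is a generator together with a flag; the flag \<^const>\<open>True\<close> marks the
  adjoint of the generator. The wrapper makes words an additive monoid under concatenation,
  so that the finitely supported functions on words are the free algebra
  with its convolution product.\<close>

datatype 'g word = Word (letters: "('g \<times> bool) list")

instantiation word :: (type) monoid_add
begin

definition zero_word :: "'a word" where
  "zero_word = Word []"

definition plus_word :: "'a word \<Rightarrow> 'a word \<Rightarrow> 'a word" where
  "plus_word u v = Word (letters u @ letters v)"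

instance
  by standard (auto simp: zero_word_def plus_word_def)

end

definition word_adj :: "'g word \<Rightarrow> 'g word" where
  "word_adj w = Word (rev (map (\<lambda>(g, b). (g, \<not> b)) (letters w)))"

lemma word_adj_adj [simp]: "word_adj (word_adj w) = w"
  by (cases w) (auto simp: word_adj_def rev_map o_def case_prod_unfold)

type_synonym 'g free_alg = "'g word \<Rightarrow>\<^sub>0 complex"

lift_definition free_star :: "'g free_alg \<Rightarrow> 'g free_alg" is
  "\<lambda>x w. cnj (x (word_adj w))"
proof -
  fix x :: "'g word \<Rightarrow> complex"
  assume "finite {w. x w \<noteq> 0}"
  then have "finite (word_adj -` {w. x w \<noteq> 0})"
    by (rule finite_vimageI) (metis injI word_adj_adj)
  then show "finite {w. cnj (x (word_adj w)) \<noteq> 0}"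
    by (simp add: vimage_def)
qed

definition free_scale :: "complex \<Rightarrow> 'g free_alg \<Rightarrow> 'g free_alg" where
  "free_scale c x = Poly_Mapping.map ((*) c) x"

definition monomial :: "('g \<times> bool) list \<Rightarrow> 'g free_alg" where
  "monomial ls = Poly_Mapping.single (Word ls) 1"

text \<open>The empty word is excluded: this is the free *-algebra without unit.\<close>

definition free_star_algebra :: "'g set \<Rightarrow> 'g free_alg set" where
  "free_star_algebra X =
     {x. \<forall>w \<in> Poly_Mapping.keys x. letters w \<noteq> [] \<and> fst ` set (letters w) \<subseteq> X}"


section \<open>Universal C*-algebras of generators and relations\<close>

definition cstar_seminorm :: "'g free_alg set \<Rightarrow> ('g free_alg \<Rightarrow> real) \<Rightarrow> bool" where
  "cstar_seminorm F p \<longleftrightarrow>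
     (\<forall>x\<in>F. 0 \<le> p x) \<and>
     (\<forall>x\<in>F. \<forall>y\<in>F. p (x + y) \<le> p x + p y \<and> p (x * y) \<le> p x * p y) \<and>
     (\<forall>c. \<forall>x\<in>F. p (free_scale c x) = cmod c * p x) \<and>
     (\<forall>x\<in>F. p (free_star x * x) = (p x)\<^sup>2)"

text \<open>The C*-seminorms on the free *-algebra that vanish on the relations \<open>R\<close> are exactly the
  functions \<open>x \<mapsto> \<parallel>\<pi> x\<parallel>\<close>, where \<open>\<pi>\<close> is the *-homomorphism given by a family
  satisfying \<open>R\<close> in some C*-algebra. If their supremum is finite, the Hausdorff completion
  with respect to it is the universal C*-algebra generated by \<open>X\<close> subject to \<open>R\<close>.\<close>

definition universal_seminorm :: "'g set \<Rightarrow> 'g free_alg set \<Rightarrow> 'g free_alg \<Rightarrow> real" where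
  "universal_seminorm X R x =
     (SUP p \<in> {p. cstar_seminorm (free_star_algebra X) p \<and> (\<forall>a\<in>R. p a = 0)}. p x)"

definition cauchy_seqs :: "'g free_alg set \<Rightarrow> ('g free_alg \<Rightarrow> real) \<Rightarrow> (nat \<Rightarrow> 'g free_alg) set" where
  "cauchy_seqs F N = {x. (\<forall>n. x n \<in> F) \<and>
     (\<forall>e>0. \<exists>M. \<forall>m\<ge>M. \<forall>n\<ge>M. N (x m - x n) < e)}"

definition seq_class ::
  "'g free_alg set \<Rightarrow> ('g free_alg \<Rightarrow> real) \<Rightarrow> (nat \<Rightarrow> 'g free_alg) \<Rightarrow> (nat \<Rightarrow> 'g free_alg) set" where
  "seq_class F N x = {y \<in> cauchy_seqs F N. (\<lambda>n. N (x n - y n)) \<longlonglongrightarrow> 0}"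

text \<open>The operations are those induced by the pointwise operations on representatives;
  each union below is a union of equal classes.\<close>

definition completion ::
  "'g free_alg set \<Rightarrow> ('g free_alg \<Rightarrow> real) \<Rightarrow> (nat \<Rightarrow> 'g free_alg) set star_alg" where
  "completion F N =
     \<lparr>carrier = seq_class F N ` cauchy_seqs F N,
      sadd = (\<lambda>a b. \<Union>x\<in>a. \<Union>y\<in>b. seq_class F N (\<lambda>n. x n + y n)),
      szero = seq_class F N (\<lambda>n. 0),
      smult = (\<lambda>a b. \<Union>x\<in>a. \<Union>y\<in>b. seq_class F N (\<lambda>n. x n * y n)),
      sscale = (\<lambda>c a. \<Union>x\<in>a. seq_class F N (\<lambda>n. free_scale c (x n))),
      sstar = (\<lambda>a. \<Union>x\<in>a. seq_class F N (\<lambda>n. free_star (x n))),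
      snorm = (\<lambda>a. THE l. \<forall>x\<in>a. (\<lambda>n. N (x n)) \<longlonglongrightarrow> l)\<rparr>"

definition universal_cstar ::
  "'g set \<Rightarrow> 'g free_alg set \<Rightarrow> (nat \<Rightarrow> 'g free_alg) set star_alg" where
  "universal_cstar X R = completion (free_star_algebra X) (universal_seminorm X R)"

definition universal_embed ::
  "'g set \<Rightarrow> 'g free_alg set \<Rightarrow> 'g free_alg \<Rightarrow> (nat \<Rightarrow> 'g free_alg) set" where
  "universal_embed X R x = seq_class (free_star_algebra X) (universal_seminorm X R) (\<lambda>n. x)"


section \<open>Graph C*-algebras\<close>

text \<open>The source and range maps of a directed graph are \<^const>\<open>tail\<close> and \<^const>\<open>head\<close>.\<close>

datatype ('v, 'e) generator = GV 'v | GE 'e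

definition graph_gens :: "('v, 'e) pre_digraph \<Rightarrow> ('v, 'e) generator set" where
  "graph_gens E = GV ` verts E \<union> GE ` arcs E"

definition fP :: "'v \<Rightarrow> ('v, 'e) generator free_alg" where
  "fP v = monomial [(GV v, False)]"

definition fS :: "'e \<Rightarrow> ('v, 'e) generator free_alg" where
  "fS e = monomial [(GE e, False)]"

text \<open>The relation \<open>S\<^sub>e S\<^sub>e\<^sup>* \<le> P\<close>, for the vertex projection \<open>P\<close> at the source of \<open>e\<close>,
  is the order of projections: \<open>q \<le> p\<close> iff \<open>p q = q\<close>. That \<open>S\<^sub>e\<close> is a partial isometry
  is contained in the requirement that \<open>S\<^sub>e\<^sup>* S\<^sub>e\<close> is a (vertex) projection.\<close>

definition graph_relations :: "('v, 'e) pre_digraph \<Rightarrow> ('v, 'e) generator free_alg set" where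
  "graph_relations E =
     {free_star (fP v) - fP v | v. v \<in> verts E} \<union>
     {fP v * fP v - fP v | v. v \<in> verts E} \<union>
     {fP v * fP w | v w. v \<in> verts E \<and> w \<in> verts E \<and> v \<noteq> w} \<union>
     {free_star (fS e) * fS e - fP (head E e) | e. e \<in> arcs E} \<union>
     {free_star (fS e) * fS f | e f. e \<in> arcs E \<and> f \<in> arcs E \<and> e \<noteq> f} \<union>
     {fP (tail E e) * (fS e * free_star (fS e)) - fS e * free_star (fS e) | e. e \<in> arcs E} \<union>
     {fP v - (\<Sum>e\<in>out_arcs E v. fS e * free_star (fS e)) | v.
        v \<in> verts E \<and> finite (out_arcs E v) \<and> out_arcs E v \<noteq> {}}"

definition graph_cstar ::
  "('v, 'e) pre_digraph \<Rightarrow> (nat \<Rightarrow> ('v, 'e) generator free_alg) set star_alg" where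
  "graph_cstar E = universal_cstar (graph_gens E) (graph_relations E)"

text \<open>The elements \<open>S\<^sub>\<mu>\<close> of the graph algebra for all paths \<open>\<mu>\<close>; a path of
  length 0 is a vertex \<open>v\<close>, with \<open>S\<^sub>v = P\<^sub>v\<close>.\<close>

definition path_elements ::
  "('v, 'e) pre_digraph \<Rightarrow> (nat \<Rightarrow> ('v, 'e) generator free_alg) set set" where
  "path_elements E =
     universal_embed (graph_gens E) (graph_relations E) `
       (fP ` verts E \<union>
        {monomial (map (\<lambda>e. (GE e, False)) \<mu>) | \<mu>.
           \<mu> \<noteq> [] \<and> (\<exists>u v. pre_digraph.awalk E u \<mu> v)})"

definition diagonal ::
  "('v, 'e) pre_digraph \<Rightarrow> (nat \<Rightarrow> ('v, 'e) generator free_alg) set set" where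
  "diagonal E = cstar_generated (graph_cstar E)
     {smult (graph_cstar E) s (sstar (graph_cstar E) s) | s. s \<in> path_elements E}"

definition weyl_group ::
  "('v, 'e) pre_digraph \<Rightarrow>
     ((nat \<Rightarrow> ('v, 'e) generator free_alg) set \<Rightarrow> (nat \<Rightarrow> ('v, 'e) generator free_alg) set) set monoid" where
  "weyl_group E =
     Aut_preserving (graph_cstar E) (diagonal E) Mod Aut_fixing (graph_cstar E) (diagonal E)"

end

theory Submission
  imports Defs
begin

text \<open>
  The idea is that an automorphism that preserves the diagonal \<open>D\<close> is determined on \<open>D\<close> by a rough
  approximation of its values on the generators \<open>P\<^sub>v\<close> and \<open>S\<^sub>e\<close>.

  Let \<open>f\<close> and \<open>g\<close> be two such automorphisms with \<open>\<parallel>f P\<^sub>v - g P\<^sub>v\<parallel> < 1\<close> and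
  \<open>\<parallel>f S\<^sub>e - g S\<^sub>e\<parallel> < 1/2\<close> for all vertices and edges. The projections \<open>f P\<^sub>v\<close> and \<open>g P\<^sub>v\<close> both lie in
  the commutative algebra \<open>D\<close>, and commuting projections at distance less than 1 are equal
  (\<open>commuting_projs_dist_less_1\<close>). If \<open>f\<close> and \<open>g\<close> agree on \<open>P\<^bsub>\<mu>\<^esub>\<close>, then, since
  \<open>P\<^bsub>e\<mu>\<^esub> = S\<^sub>e P\<^bsub>\<mu>\<^esub> S\<^sub>e\<^sup>\<star>\<close>, the projections \<open>f P\<^bsub>e\<mu>\<^esub>\<close> and \<open>g P\<^bsub>e\<mu>\<^esub>\<close> are again at distance less than 1,
  hence equal (\<open>close_star_endos_agree\<close>). So \<open>f\<close> and \<open>g\<close> agree on all path projections, and by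
  continuity on \<open>D\<close>; then they lie in the same coset (\<open>Aut_fixing_coset_eq\<close>).

  Since the graph is finite, an automorphism restricts to a finite tuple of elements of the algebra on
  the generators. The algebra is separable (\<open>countable_dense_free_star_algebra\<close>,
  \<open>completion_dense\<close>), so countably many tuples approximate all of them within \<open>1/4\<close>, and
  automorphisms with a common approximation are close in the above sense.

  Two facts about C*-algebras enter. First, *-endomorphisms are continuous
  (\<open>star_endo_bounded\<close>). Contractivity is usually derived from the spectral radius; a bound by 2
  suffices here, and it follows from one square root and one unitary. Second, the universal
  seminorm is finite and its completion is a C*-algebra (\<open>universal_seminorm_cstar_seminorm\<close>,
  \<open>completion_cstar_algebra\<close>).
\<close>

section \<open>C*-algebras on a carrier\<close>

lemma null_comparison:
  fixes f g :: "nat \<Rightarrow> real"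
  assumes "f \<longlonglongrightarrow> 0" "\<And>n. \<bar>g n\<bar> \<le> f n"
  shows "g \<longlonglongrightarrow> 0"
  by (rule tendsto_0_le[OF assms(1), where K=1])
    (auto intro!: always_eventually order_trans[OF assms(2)])

lemma le_if_square_le_mult: "a * a \<le> b * a \<Longrightarrow> 0 \<le> a \<Longrightarrow> 0 \<le> b \<Longrightarrow> a \<le> b" for a b :: real
  by (cases "a = 0") (auto intro: mult_right_le_imp_le)

notation sadd (infixl "\<boxplus>\<index>" 65)
notation smult (infixl "\<boxdot>\<index>" 70)
notation sscale (infixr "\<cdot>\<index>" 75)
notation sstar ("(_\<^sup>\<star>\<index>)" [1000] 1000)
notation snorm ("\<parallel>_\<parallel>\<index>")
notation szero ("\<zero>\<^sub>s\<index>")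

text \<open>Written so that \<^const>\<open>sdist\<close> is the norm of a difference.\<close>
abbreviation sminus :: "'a star_alg \<Rightarrow> 'a \<Rightarrow> 'a \<Rightarrow> 'a"  (infixl "\<boxminus>\<index>" 65) where
  "sminus A x y \<equiv> sadd A x (sscale A (-1) y)"

locale cstar_algebra =
  fixes A :: "'a star_alg" (structure)
  assumes zero_closed [simp]: "\<zero>\<^sub>s \<in> carrier A"
    and add_closed [simp]: "x \<in> carrier A \<Longrightarrow> y \<in> carrier A \<Longrightarrow> x \<boxplus> y \<in> carrier A"
    and mult_closed [simp]: "x \<in> carrier A \<Longrightarrow> y \<in> carrier A \<Longrightarrow> x \<boxdot> y \<in> carrier A"
    and scale_closed [simp]: "x \<in> carrier A \<Longrightarrow> c \<cdot> x \<in> carrier A"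
    and star_closed [simp]: "x \<in> carrier A \<Longrightarrow> x\<^sup>\<star> \<in> carrier A"
    and add_assoc: "x \<in> carrier A \<Longrightarrow> y \<in> carrier A \<Longrightarrow> z \<in> carrier A \<Longrightarrow> x \<boxplus> y \<boxplus> z = x \<boxplus> (y \<boxplus> z)"
    and add_comm: "x \<in> carrier A \<Longrightarrow> y \<in> carrier A \<Longrightarrow> x \<boxplus> y = y \<boxplus> x"
    and add_zero [simp]: "x \<in> carrier A \<Longrightarrow> x \<boxplus> \<zero>\<^sub>s = x"
    and mult_assoc: "x \<in> carrier A \<Longrightarrow> y \<in> carrier A \<Longrightarrow> z \<in> carrier A \<Longrightarrow> x \<boxdot> y \<boxdot> z = x \<boxdot> (y \<boxdot> z)"
    and distrib_right: "x \<in> carrier A \<Longrightarrow> y \<in> carrier A \<Longrightarrow> z \<in> carrier A \<Longrightarrow> (x \<boxplus> y) \<boxdot> z = x \<boxdot> z \<boxplus> y \<boxdot> z"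
    and distrib_left: "x \<in> carrier A \<Longrightarrow> y \<in> carrier A \<Longrightarrow> z \<in> carrier A \<Longrightarrow> z \<boxdot> (x \<boxplus> y) = z \<boxdot> x \<boxplus> z \<boxdot> y"
    and scale_one [simp]: "x \<in> carrier A \<Longrightarrow> 1 \<cdot> x = x"
    and scale_zero [simp]: "x \<in> carrier A \<Longrightarrow> 0 \<cdot> x = \<zero>\<^sub>s"
    and scale_scale [simp]: "x \<in> carrier A \<Longrightarrow> c \<cdot> d \<cdot> x = (c * d) \<cdot> x"
    and scale_add_left: "x \<in> carrier A \<Longrightarrow> (c + d) \<cdot> x = c \<cdot> x \<boxplus> d \<cdot> x"
    and scale_add_right: "x \<in> carrier A \<Longrightarrow> y \<in> carrier A \<Longrightarrow> c \<cdot> (x \<boxplus> y) = c \<cdot> x \<boxplus> c \<cdot> y"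
    and mult_scale_left [simp]: "x \<in> carrier A \<Longrightarrow> y \<in> carrier A \<Longrightarrow> (c \<cdot> x) \<boxdot> y = c \<cdot> (x \<boxdot> y)"
    and mult_scale_right [simp]: "x \<in> carrier A \<Longrightarrow> y \<in> carrier A \<Longrightarrow> x \<boxdot> (c \<cdot> y) = c \<cdot> (x \<boxdot> y)"
    and star_add: "x \<in> carrier A \<Longrightarrow> y \<in> carrier A \<Longrightarrow> (x \<boxplus> y)\<^sup>\<star> = x\<^sup>\<star> \<boxplus> y\<^sup>\<star>"
    and star_mult: "x \<in> carrier A \<Longrightarrow> y \<in> carrier A \<Longrightarrow> (x \<boxdot> y)\<^sup>\<star> = y\<^sup>\<star> \<boxdot> x\<^sup>\<star>"
    and star_scale: "x \<in> carrier A \<Longrightarrow> (c \<cdot> x)\<^sup>\<star> = cnj c \<cdot> x\<^sup>\<star>"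
    and star_star [simp]: "x \<in> carrier A \<Longrightarrow> x\<^sup>\<star>\<^sup>\<star> = x"
    and norm_ge_0 [simp]: "x \<in> carrier A \<Longrightarrow> 0 \<le> \<parallel>x\<parallel>"
    and norm_triangle: "x \<in> carrier A \<Longrightarrow> y \<in> carrier A \<Longrightarrow> \<parallel>x \<boxplus> y\<parallel> \<le> \<parallel>x\<parallel> + \<parallel>y\<parallel>"
    and norm_mult: "x \<in> carrier A \<Longrightarrow> y \<in> carrier A \<Longrightarrow> \<parallel>x \<boxdot> y\<parallel> \<le> \<parallel>x\<parallel> * \<parallel>y\<parallel>"
    and norm_scale [simp]: "x \<in> carrier A \<Longrightarrow> \<parallel>c \<cdot> x\<parallel> = cmod c * \<parallel>x\<parallel>"
    and norm_star_mult: "x \<in> carrier A \<Longrightarrow> \<parallel>x\<^sup>\<star> \<boxdot> x\<parallel> = \<parallel>x\<parallel>\<^sup>2"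
    and norm_eq_0: "x \<in> carrier A \<Longrightarrow> \<parallel>x\<parallel> = 0 \<Longrightarrow> x = \<zero>\<^sub>s"
    and complete: "(\<And>n. X n \<in> carrier A) \<Longrightarrow>
      (\<And>e. e > 0 \<Longrightarrow> \<exists>M. \<forall>m\<ge>M. \<forall>n\<ge>M. sdist A (X m) (X n) < e) \<Longrightarrow>
      \<exists>a\<in>carrier A. (\<lambda>n. sdist A (X n) a) \<longlonglongrightarrow> 0"
begin

lemma add_left_comm:
  "x \<in> carrier A \<Longrightarrow> y \<in> carrier A \<Longrightarrow> z \<in> carrier A \<Longrightarrow> x \<boxplus> (y \<boxplus> z) = y \<boxplus> (x \<boxplus> z)"
  by (metis add_assoc add_comm)

lemma zero_add [simp]: "x \<in> carrier A \<Longrightarrow> \<zero>\<^sub>s \<boxplus> x = x"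
  by (simp add: add_comm)

lemma minus_self [simp]: "x \<in> carrier A \<Longrightarrow> x \<boxminus> x = \<zero>\<^sub>s"
  using scale_add_left[of x 1 "-1"] by simp

lemma minus_self_left [simp]:
  "x \<in> carrier A \<Longrightarrow> y \<in> carrier A \<Longrightarrow> x \<boxplus> (-1 \<cdot> x \<boxplus> y) = y"
  by (simp add: add_assoc[symmetric])

lemma minus_self_left' [simp]:
  "x \<in> carrier A \<Longrightarrow> y \<in> carrier A \<Longrightarrow> -1 \<cdot> x \<boxplus> (x \<boxplus> y) = y"
  by (simp add: add_comm[of _ x] flip: add_assoc)

lemma scale_zero_right [simp]: "c \<cdot> \<zero>\<^sub>s = \<zero>\<^sub>s"
  by (metis scale_scale scale_zero mult_zero_right zero_closed)

lemma mult_zero [simp]: "x \<in> carrier A \<Longrightarrow> x \<boxdot> \<zero>\<^sub>s = \<zero>\<^sub>s" "x \<in> carrier A \<Longrightarrow> \<zero>\<^sub>s \<boxdot> x = \<zero>\<^sub>s"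
  using mult_scale_right[of x "\<zero>\<^sub>s" 0] mult_scale_left[of "\<zero>\<^sub>s" x 0] by simp_all

lemma star_zero [simp]: "\<zero>\<^sub>s\<^sup>\<star> = \<zero>\<^sub>s"
  using star_scale[of "\<zero>\<^sub>s" 0] by simp

lemma norm_zero [simp]: "\<parallel>\<zero>\<^sub>s\<parallel> = 0"
  using norm_scale[of "\<zero>\<^sub>s" 0] by simp

lemma minus_eq_zero_iff: "x \<in> carrier A \<Longrightarrow> y \<in> carrier A \<Longrightarrow> x \<boxminus> y = \<zero>\<^sub>s \<longleftrightarrow> x = y"
  by (metis add_comm minus_self minus_self_left add_zero scale_closed)

lemma eq_if_norm_minus_eq_0: "x \<in> carrier A \<Longrightarrow> y \<in> carrier A \<Longrightarrow> \<parallel>x \<boxminus> y\<parallel> = 0 \<Longrightarrow> x = y"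
  using norm_eq_0[of "x \<boxminus> y"] by (simp add: minus_eq_zero_iff)

lemma minus_split:
  "x \<in> carrier A \<Longrightarrow> y \<in> carrier A \<Longrightarrow> z \<in> carrier A \<Longrightarrow> x \<boxminus> z = (x \<boxminus> y) \<boxplus> (y \<boxminus> z)"
  by (simp add: add_assoc)

lemma norm_minus_triangle:
  "x \<in> carrier A \<Longrightarrow> y \<in> carrier A \<Longrightarrow> z \<in> carrier A \<Longrightarrow> \<parallel>x \<boxminus> z\<parallel> \<le> \<parallel>x \<boxminus> y\<parallel> + \<parallel>y \<boxminus> z\<parallel>"
  using norm_triangle[of "x \<boxminus> y" "y \<boxminus> z"] by (simp add: minus_split[of x y z])

lemma minus_swap: "x \<in> carrier A \<Longrightarrow> y \<in> carrier A \<Longrightarrow> x \<boxminus> y = -1 \<cdot> (y \<boxminus> x)"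
  using add_comm[of x "-1 \<cdot> y"] by (simp add: scale_add_right)

lemma norm_minus_commute: "x \<in> carrier A \<Longrightarrow> y \<in> carrier A \<Longrightarrow> \<parallel>x \<boxminus> y\<parallel> = \<parallel>y \<boxminus> x\<parallel>"
  using norm_scale[of "y \<boxminus> x" "-1"] minus_swap[of x y] by auto

lemma norm_star [simp]:
  assumes "x \<in> carrier A"
  shows "\<parallel>x\<^sup>\<star>\<parallel> = \<parallel>x\<parallel>"
proof -
  have le: "\<parallel>y\<parallel> \<le> \<parallel>y\<^sup>\<star>\<parallel>" if "y \<in> carrier A" for y
    using norm_mult[of "y\<^sup>\<star>" y] norm_star_mult[of y] that
    by (intro le_if_square_le_mult[of "\<parallel>y\<parallel>" "\<parallel>y\<^sup>\<star>\<parallel>"]) (simp_all add: power2_eq_square)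
  show ?thesis
    using le[of x] le[of "x\<^sup>\<star>"] assms by simp
qed

text \<open>Split \<open>x y - a b = (x - a) y + a (y - b)\<close>. This gives the contraction estimate of a
  square-root iteration and the continuity of \<open>x \<mapsto> s x s\<^sup>\<star>\<close> in \<open>s\<close>.\<close>
lemma mult_diff_bound:
  assumes [simp]: "x \<in> carrier A" "y \<in> carrier A" "a \<in> carrier A" "b \<in> carrier A"
  shows "\<parallel>x \<boxdot> y \<boxminus> a \<boxdot> b\<parallel> \<le> \<parallel>x \<boxminus> a\<parallel> * \<parallel>y\<parallel> + \<parallel>a\<parallel> * \<parallel>y \<boxminus> b\<parallel>"
proof -
  have "\<parallel>x \<boxdot> y \<boxminus> a \<boxdot> b\<parallel> \<le> \<parallel>x \<boxdot> y \<boxminus> a \<boxdot> y\<parallel> + \<parallel>a \<boxdot> y \<boxminus> a \<boxdot> b\<parallel>"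
    by (rule norm_minus_triangle) simp_all
  also have "\<dots> = \<parallel>(x \<boxminus> a) \<boxdot> y\<parallel> + \<parallel>a \<boxdot> (y \<boxminus> b)\<parallel>"
    by (simp add: distrib_left distrib_right)
  also have "\<dots> \<le> \<parallel>x \<boxminus> a\<parallel> * \<parallel>y\<parallel> + \<parallel>a\<parallel> * \<parallel>y \<boxminus> b\<parallel>"
    by (intro add_mono norm_mult) simp_all
  finally show ?thesis .
qed


section \<open>Convergence\<close>

definition converges :: "(nat \<Rightarrow> 'a) \<Rightarrow> 'a \<Rightarrow> bool" where
  "converges X a \<longleftrightarrow> (\<forall>n. X n \<in> carrier A) \<and> a \<in> carrier A \<and> (\<lambda>n. \<parallel>X n \<boxminus> a\<parallel>) \<longlonglongrightarrow> 0"

lemma convergesD: "converges X a \<Longrightarrow> X n \<in> carrier A" "converges X a \<Longrightarrow> a \<in> carrier A"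
  by (simp_all add: converges_def)

lemma converges_by_bound:
  assumes "converges X a" "\<And>n. Y n \<in> carrier A" "b \<in> carrier A"
    "\<And>n. \<parallel>Y n \<boxminus> b\<parallel> \<le> \<parallel>X n \<boxminus> a\<parallel> * c"
  shows "converges Y b"
proof -
  have "(\<lambda>n. \<parallel>X n \<boxminus> a\<parallel> * c) \<longlonglongrightarrow> 0"
    using assms(1) by (auto simp: converges_def intro: tendsto_mult_left_zero)
  then have "(\<lambda>n. \<parallel>Y n \<boxminus> b\<parallel>) \<longlonglongrightarrow> 0"
    by (rule null_comparison)
      (use assms in \<open>simp add: convergesD[OF assms(1)]\<close>)
  then show ?thesis
    using assms by (simp add: converges_def)
qed

lemma converges_unique:
  assumes "converges X a" "converges X b"
  shows "a = b"
proof -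
  note [simp] = convergesD[OF assms(1)] convergesD[OF assms(2)]
  have "(\<lambda>n. \<parallel>X n \<boxminus> a\<parallel> + \<parallel>X n \<boxminus> b\<parallel>) \<longlonglongrightarrow> 0 + 0"
    using assms by (intro tendsto_add) (simp_all add: converges_def)
  moreover have "\<parallel>a \<boxminus> b\<parallel> \<le> \<parallel>X n \<boxminus> a\<parallel> + \<parallel>X n \<boxminus> b\<parallel>" for n
    using norm_minus_triangle[of a "X n" b] norm_minus_commute[of a "X n"] by simp
  ultimately have "\<parallel>a \<boxminus> b\<parallel> \<le> 0"
    using LIMSEQ_le_const[of "\<lambda>n. \<parallel>X n \<boxminus> a\<parallel> + \<parallel>X n \<boxminus> b\<parallel>" 0 "\<parallel>a \<boxminus> b\<parallel>"] by auto
  then show ?thesis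
    by (intro eq_if_norm_minus_eq_0) (simp_all add: order_antisym)
qed

lemma converges_mult_right:
  assumes X: "converges X a" and y: "y \<in> carrier A"
  shows "converges (\<lambda>n. X n \<boxdot> y) (a \<boxdot> y)"
proof (rule converges_by_bound[OF X])
  note [simp] = convergesD[OF X] y
  show "\<parallel>X n \<boxdot> y \<boxminus> a \<boxdot> y\<parallel> \<le> \<parallel>X n \<boxminus> a\<parallel> * \<parallel>y\<parallel>" for n
    using norm_mult[of "X n \<boxminus> a" y] by (simp add: distrib_right)
qed (use y convergesD[OF X] in simp_all)

lemma converges_mult_left:
  assumes X: "converges X a" and y: "y \<in> carrier A"
  shows "converges (\<lambda>n. y \<boxdot> X n) (y \<boxdot> a)"
proof (rule converges_by_bound[OF X])
  note [simp] = convergesD[OF X] y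
  show "\<parallel>y \<boxdot> X n \<boxminus> y \<boxdot> a\<parallel> \<le> \<parallel>X n \<boxminus> a\<parallel> * \<parallel>y\<parallel>" for n
    using norm_mult[of y "X n \<boxminus> a"] by (simp add: distrib_left mult.commute)
qed (use y convergesD[OF X] in simp_all)

lemma converges_star:
  assumes "converges X a"
  shows "converges (\<lambda>n. (X n)\<^sup>\<star>) (a\<^sup>\<star>)"
proof (rule converges_by_bound[OF assms, where c=1])
  note [simp] = convergesD[OF assms]
  have "(X n)\<^sup>\<star> \<boxminus> a\<^sup>\<star> = (X n \<boxminus> a)\<^sup>\<star>" for n
    by (simp add: star_add star_scale)
  then show "\<parallel>(X n)\<^sup>\<star> \<boxminus> a\<^sup>\<star>\<parallel> \<le> \<parallel>X n \<boxminus> a\<parallel> * 1" for n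
    by simp
qed (use assms convergesD[OF assms] in simp_all)

lemma converges_Suc: "converges X a \<Longrightarrow> converges (\<lambda>n. X (Suc n)) a"
  unfolding converges_def using LIMSEQ_Suc by auto

end

section \<open>Continuity of *-endomorphisms\<close>

definition (in cstar_algebra) star_endo :: "('a \<Rightarrow> 'a) \<Rightarrow> bool" where
  "star_endo f \<longleftrightarrow>
     (\<forall>x\<in>carrier A. f x \<in> carrier A) \<and>
     (\<forall>x\<in>carrier A. \<forall>y\<in>carrier A. f (x \<boxplus> y) = f x \<boxplus> f y \<and> f (x \<boxdot> y) = f x \<boxdot> f y) \<and>
     (\<forall>c. \<forall>x\<in>carrier A. f (c \<cdot> x) = c \<cdot> f x) \<and>
     (\<forall>x\<in>carrier A. f (x\<^sup>\<star>) = (f x)\<^sup>\<star>)"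

context cstar_algebra
begin

lemma star_endoD:
  assumes "star_endo f"
  shows "x \<in> carrier A \<Longrightarrow> f x \<in> carrier A"
    and "x \<in> carrier A \<Longrightarrow> y \<in> carrier A \<Longrightarrow> f (x \<boxplus> y) = f x \<boxplus> f y"
    and "x \<in> carrier A \<Longrightarrow> y \<in> carrier A \<Longrightarrow> f (x \<boxdot> y) = f x \<boxdot> f y"
    and "x \<in> carrier A \<Longrightarrow> f (c \<cdot> x) = c \<cdot> f x"
    and "x \<in> carrier A \<Longrightarrow> f (x\<^sup>\<star>) = (f x)\<^sup>\<star>"
  using assms by (simp_all add: star_endo_def)

lemma geometric_converges:
  assumes y: "\<And>n. y n \<in> carrier A" and step: "\<And>n. \<parallel>y (Suc n) \<boxminus> y n\<parallel> \<le> (1/2) ^ n"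
  shows "\<exists>a. converges y a"
proof -
  have bound: "\<parallel>y (n + k) \<boxminus> y n\<parallel> \<le> 2 * (1/2) ^ n - 2 * (1/2) ^ (n + k)" for n k
  proof (induction k)
    case 0
    then show ?case by (simp add: y)
  next
    case (Suc k)
    have "\<parallel>y (n + Suc k) \<boxminus> y n\<parallel> \<le> \<parallel>y (Suc (n + k)) \<boxminus> y (n + k)\<parallel> + \<parallel>y (n + k) \<boxminus> y n\<parallel>"
      using norm_minus_triangle[OF y y y, of "Suc (n + k)" n "n + k"] by simp
    then show ?case
      using Suc step[of "n + k"] by simp
  qed
  have "\<exists>M. \<forall>m\<ge>M. \<forall>n\<ge>M. sdist A (y m) (y n) < e" if e: "e > 0" for e
  proof -
    obtain M where M: "(1/2::real) ^ M < e / 4"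
      using real_arch_pow_inv[of "e/4" "1/2"] e by auto
    have near: "\<parallel>y m \<boxminus> y M\<parallel> < e / 2" if "m \<ge> M" for m
    proof -
      have "\<parallel>y m \<boxminus> y M\<parallel> \<le> 2 * (1/2) ^ M - 2 * (1/2) ^ m"
        using bound[of M "m - M"] that by simp
      also have "\<dots> \<le> 2 * (1/2) ^ M"
        by simp
      finally show ?thesis
        using M by simp
    qed
    have "sdist A (y m) (y n) < e" if "m \<ge> M" "n \<ge> M" for m n
      using near[OF that(1)] near[OF that(2)] norm_minus_triangle[OF y y y, of m n M]
        norm_minus_commute[OF y y, of n M] by (simp add: sdist_def)
    then show ?thesis
      by blast
  qed
  then obtain a where "a \<in> carrier A" "(\<lambda>n. sdist A (y n) a) \<longlonglongrightarrow> 0"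
    using complete[of y] y by blast
  then show ?thesis
    using y unfolding converges_def sdist_def by blast
qed

text \<open>In the unitization the pair \<open>(x, 1 - y)\<close> lies on the unit circle, that is,
  \<open>1 - y\<close> is a square root of \<open>1 - x\<^sup>2\<close>. Such a \<open>y\<close> is the fixed point of
  \<open>z \<mapsto> (x\<^sup>2 + z\<^sup>2) / 2\<close>, a contraction of the ball of radius \<open>1/2\<close>. The iterates are
  real polynomials in \<open>x\<close>, so the limit is self-adjoint and commutes with \<open>x\<close>.
  The relations that \<open>y\<close> satisfies are algebraic, hence preserved by every *-endomorphism.\<close>
lemma self_adjoint_on_circle:
  assumes x [simp]: "x \<in> carrier A" and sa: "x\<^sup>\<star> = x" and small: "\<parallel>x\<parallel> \<le> 1/2"
  obtains y where "y \<in> carrier A" "y\<^sup>\<star> = y" "x \<boxdot> y = y \<boxdot> x" "x \<boxdot> x \<boxplus> y \<boxdot> y = 2 \<cdot> y"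
proof -
  define y where "y = rec_nat \<zero>\<^sub>s (\<lambda>_ z. (1/2) \<cdot> (x \<boxdot> x \<boxplus> z \<boxdot> z))"
  have y0: "y 0 = \<zero>\<^sub>s" and ySuc: "y (Suc n) = (1/2) \<cdot> (x \<boxdot> x \<boxplus> y n \<boxdot> y n)" for n
    by (simp_all add: y_def)
  have y [simp]: "y n \<in> carrier A" for n
    by (induction n) (simp_all add: y0 ySuc)
  have y_sa: "(y n)\<^sup>\<star> = y n" for n
    by (induction n) (simp_all add: y0 ySuc star_scale star_add star_mult sa)
  have y_comm: "x \<boxdot> y n = y n \<boxdot> x" for n
  proof (induction n)
    case (Suc n)
    have "x \<boxdot> (y n \<boxdot> y n) = (y n \<boxdot> y n) \<boxdot> x"
      using Suc by (metis mult_assoc x y)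
    then show ?case
      by (simp add: ySuc distrib_left distrib_right mult_assoc)
  qed (simp add: y0)
  have xx: "\<parallel>x \<boxdot> x\<parallel> \<le> 1/4"
    using norm_mult[of x x] mult_mono[OF small small] by simp
  have y_norm: "\<parallel>y n\<parallel> \<le> 1/2" for n
  proof (induction n)
    case (Suc n)
    have "\<parallel>y n \<boxdot> y n\<parallel> \<le> 1/4"
      using norm_mult[of "y n" "y n"] mult_mono[OF Suc Suc] by simp
    then show ?case
      using xx norm_triangle[of "x \<boxdot> x" "y n \<boxdot> y n"] by (simp add: ySuc)
  qed (simp add: y0)
  have diff: "y (Suc m) \<boxminus> y (Suc n) = (1/2) \<cdot> (y m \<boxdot> y m \<boxminus> y n \<boxdot> y n)" for m n
  proof -
    have "x \<boxdot> x \<boxplus> y m \<boxdot> y m \<boxminus> (x \<boxdot> x \<boxplus> y n \<boxdot> y n) = y m \<boxdot> y m \<boxminus> y n \<boxdot> y n"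
      using add_left_comm[of "y m \<boxdot> y m" "-1 \<cdot> (x \<boxdot> x)" "-1 \<cdot> (y n \<boxdot> y n)"]
      by (simp add: scale_add_right add_assoc)
    moreover have "y (Suc m) \<boxminus> y (Suc n) = (1/2) \<cdot> (x \<boxdot> x \<boxplus> y m \<boxdot> y m \<boxminus> (x \<boxdot> x \<boxplus> y n \<boxdot> y n))"
      by (simp add: ySuc scale_add_right)
    ultimately show ?thesis
      by simp
  qed
  have contract: "\<parallel>y (Suc m) \<boxminus> y (Suc n)\<parallel> \<le> 1/2 * \<parallel>y m \<boxminus> y n\<parallel>" for m n
  proof -
    have "\<parallel>y m \<boxdot> y m \<boxminus> y n \<boxdot> y n\<parallel> \<le> \<parallel>y m \<boxminus> y n\<parallel> * \<parallel>y m\<parallel> + \<parallel>y n\<parallel> * \<parallel>y m \<boxminus> y n\<parallel>"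
      by (rule mult_diff_bound) simp_all
    also have "\<dots> \<le> \<parallel>y m \<boxminus> y n\<parallel> * (1/2) + (1/2) * \<parallel>y m \<boxminus> y n\<parallel>"
      by (intro add_mono mult_left_mono mult_right_mono y_norm) simp_all
    finally show ?thesis
      by (simp add: diff)
  qed
  have step: "\<parallel>y (Suc n) \<boxminus> y n\<parallel> \<le> (1/2) ^ n" for n
  proof (induction n)
    case 0
    then show ?case
      using y_norm[of 1] by (simp add: y0)
  next
    case (Suc n)
    then show ?case
      using contract[of "Suc n" n] by simp
  qed
  obtain b where b: "converges y b"
    using geometric_converges[OF y step] by blast
  note [simp] = convergesD(2)[OF b]
  have "converges (\<lambda>n. y (Suc n)) ((1/2) \<cdot> (x \<boxdot> x \<boxplus> b \<boxdot> b))"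
  proof (rule converges_by_bound[OF b])
    fix n
    have "(x \<boxdot> x \<boxplus> y n \<boxdot> y n) \<boxminus> (x \<boxdot> x \<boxplus> b \<boxdot> b) = y n \<boxdot> y n \<boxminus> b \<boxdot> b"
      using add_left_comm[of "y n \<boxdot> y n" "-1 \<cdot> (x \<boxdot> x)" "-1 \<cdot> (b \<boxdot> b)"]
      by (simp add: scale_add_right add_assoc)
    moreover have "y (Suc n) \<boxminus> (1/2) \<cdot> (x \<boxdot> x \<boxplus> b \<boxdot> b) =
        (1/2) \<cdot> ((x \<boxdot> x \<boxplus> y n \<boxdot> y n) \<boxminus> (x \<boxdot> x \<boxplus> b \<boxdot> b))"
      by (simp add: ySuc scale_add_right)
    ultimately have "\<parallel>y (Suc n) \<boxminus> (1/2) \<cdot> (x \<boxdot> x \<boxplus> b \<boxdot> b)\<parallel> = 1/2 * \<parallel>y n \<boxdot> y n \<boxminus> b \<boxdot> b\<parallel>"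
      by simp
    also have "\<dots> \<le> 1/2 * (\<parallel>y n \<boxminus> b\<parallel> * \<parallel>y n\<parallel> + \<parallel>b\<parallel> * \<parallel>y n \<boxminus> b\<parallel>)"
      by (intro mult_left_mono mult_diff_bound) simp_all
    also have "\<dots> \<le> 1/2 * (\<parallel>y n \<boxminus> b\<parallel> * (1/2) + \<parallel>b\<parallel> * \<parallel>y n \<boxminus> b\<parallel>)"
      by (intro mult_left_mono add_mono y_norm order_refl) simp_all
    also have "\<dots> = \<parallel>y n \<boxminus> b\<parallel> * (1/4 + \<parallel>b\<parallel>/2)"
      by (simp add: algebra_simps)
    finally show "\<parallel>y (Suc n) \<boxminus> (1/2) \<cdot> (x \<boxdot> x \<boxplus> b \<boxdot> b)\<parallel> \<le> \<parallel>y n \<boxminus> b\<parallel> * (1/4 + \<parallel>b\<parallel>/2)" .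
  qed simp_all
  then have "b = (1/2) \<cdot> (x \<boxdot> x \<boxplus> b \<boxdot> b)"
    by (rule converges_unique[OF converges_Suc[OF b]])
  then have "2 \<cdot> b = 2 \<cdot> (1/2) \<cdot> (x \<boxdot> x \<boxplus> b \<boxdot> b)"
    by (rule arg_cong)
  also have "\<dots> = x \<boxdot> x \<boxplus> b \<boxdot> b"
    by simp
  finally have "x \<boxdot> x \<boxplus> b \<boxdot> b = 2 \<cdot> b" ..
  moreover have "b\<^sup>\<star> = b"
    using converges_unique[OF converges_star[OF b]] b by (simp add: y_sa)
  moreover have "x \<boxdot> b = b \<boxdot> x"
    using converges_unique[OF converges_mult_left[OF b x]] converges_mult_right[OF b x] by (simp add: y_comm)
  ultimately show ?thesis
    using that[of b] by simp
qed

text \<open>The hypotheses say that \<open>a + \<i> (1 - b)\<close> is unitary in the unitization, and the real part of a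
  unitary is bounded.\<close>
lemma norm_le_2_if_on_circle:
  assumes [simp]: "a \<in> carrier A" "b \<in> carrier A" and sa: "a\<^sup>\<star> = a" "b\<^sup>\<star> = b"
    and comm: "a \<boxdot> b = b \<boxdot> a" and circle: "a \<boxdot> a \<boxplus> b \<boxdot> b = 2 \<cdot> b"
  shows "\<parallel>a\<parallel> \<le> 2"
proof -
  \<comment> \<open>Multiplying the unitary by \<open>-\<i>\<close> gives \<open>1 + w\<close>. Unitarity reads
    \<open>w\<^sup>\<star> w = -(w + w\<^sup>\<star>)\<close>, and this equation lives in the algebra itself.\<close>
  define w where "w = (-\<i>) \<cdot> a \<boxminus> b"
  have w [simp]: "w \<in> carrier A"
    by (simp add: w_def)
  have w_star: "w\<^sup>\<star> = \<i> \<cdot> a \<boxminus> b"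
    by (simp add: w_def star_add star_scale sa)
  have cancel: "c \<cdot> z \<boxplus> ((-c) \<cdot> z \<boxplus> r) = r" if "z \<in> carrier A" "r \<in> carrier A" for c z r
  proof -
    have "c \<cdot> z \<boxplus> (-c) \<cdot> z = \<zero>\<^sub>s"
      using that scale_add_left[of z c "-c"] by simp
    then show ?thesis
      using that by (simp flip: add_assoc)
  qed
  have "w\<^sup>\<star> \<boxdot> w = a \<boxdot> a \<boxplus> b \<boxdot> b"
    unfolding w_star unfolding w_def
    using cancel[of "b \<boxdot> a" "b \<boxdot> b" "\<i>"] cancel[of "b \<boxdot> a" "b \<boxdot> b" "-\<i>"]
    by (simp add: distrib_left distrib_right scale_add_right add_assoc comm)
  also have "\<dots> = 2 \<cdot> b"
    by (rule circle)
  finally have ww: "\<parallel>w\<parallel>\<^sup>2 = 2 * \<parallel>b\<parallel>"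
    by (metis assms(2) norm_numeral norm_scale norm_star_mult w)
  have "w \<boxplus> w\<^sup>\<star> = (-2) \<cdot> b"
    unfolding w_star unfolding w_def
    using cancel[of a "-1 \<cdot> b \<boxminus> b" "-\<i>"] add_left_comm[of "-1 \<cdot> b" "\<i> \<cdot> a" "-1 \<cdot> b"] scale_add_left[of b "-1" "-1"]
    by (simp add: add_assoc)
  then have "2 * \<parallel>b\<parallel> = \<parallel>w \<boxplus> w\<^sup>\<star>\<parallel>"
    by simp
  also have "\<dots> \<le> \<parallel>w\<parallel> + \<parallel>w\<parallel>"
    using norm_triangle[of w "w\<^sup>\<star>"] by simp
  finally have "\<parallel>w\<parallel> * \<parallel>w\<parallel> \<le> 2 * \<parallel>w\<parallel>"
    using ww by (simp add: power2_eq_square)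
  then have w2: "\<parallel>w\<parallel> \<le> 2"
    by (intro le_if_square_le_mult[of "\<parallel>w\<parallel>" 2]) simp_all
  have "w \<boxminus> w\<^sup>\<star> = (-2 * \<i>) \<cdot> a"
    unfolding w_star unfolding w_def
    using minus_self_left'[of b "-\<i> \<cdot> a"] add_comm[of b "-\<i> \<cdot> a"] scale_add_left[of a "-\<i>" "-\<i>"]
    by (simp add: add_assoc scale_add_right)
  then have "2 * \<parallel>a\<parallel> = \<parallel>w \<boxminus> w\<^sup>\<star>\<parallel>"
    by (simp add: norm_mult)
  also have "\<dots> \<le> \<parallel>w\<parallel> + \<parallel>w\<parallel>"
    using norm_triangle[of w "-1 \<cdot> w\<^sup>\<star>"] by simp
  finally show ?thesis
    using w2 by simp
qed

text \<open>Boundedness is automatic: for a small self-adjoint \<open>x\<close> the equations of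
  a point on the unit circle pass from \<open>x\<close> to \<open>f x\<close>. The C*-identity carries the bound over to
  arbitrary elements.\<close>
lemma star_endo_bounded:
  assumes f: "star_endo f" and x [simp]: "x \<in> carrier A"
  shows "\<parallel>f x\<parallel> \<le> 2 * \<parallel>x\<parallel>"
proof -
  note fD = star_endoD[OF f]
  have small: "\<parallel>f z\<parallel> \<le> 2" if z: "z \<in> carrier A" "z\<^sup>\<star> = z" "\<parallel>z\<parallel> \<le> 1/2" for z
  proof -
    obtain y where y: "y \<in> carrier A" "y\<^sup>\<star> = y" "z \<boxdot> y = y \<boxdot> z" "z \<boxdot> z \<boxplus> y \<boxdot> y = 2 \<cdot> y"
      using self_adjoint_on_circle[OF z] by blast
    show ?thesis
    proof (rule norm_le_2_if_on_circle)
      show "f z \<in> carrier A" "f y \<in> carrier A" "(f z)\<^sup>\<star> = f z" "(f y)\<^sup>\<star> = f y"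
        using y z fD by metis+
      show "f z \<boxdot> f y = f y \<boxdot> f z"
        using y z fD by metis
      show "f z \<boxdot> f z \<boxplus> f y \<boxdot> f y = 2 \<cdot> f y"
        using y z fD mult_closed by metis
    qed
  qed
  have self_adjoint: "\<parallel>f z\<parallel> \<le> 4 * \<parallel>z\<parallel>" if z: "z \<in> carrier A" "z\<^sup>\<star> = z" for z
  proof (cases "\<parallel>z\<parallel> = 0")
    case True
    then have "z = 0 \<cdot> z"
      using norm_eq_0[of z] z by simp
    then show ?thesis
      using True fD(1,4)[of z] z by (metis norm_scale norm_zero scale_zero mult_zero_right order_refl)
  next
    case False
    then have pos: "\<parallel>z\<parallel> > 0"
      using z norm_ge_0[of z] by linarith
    define c where "c = complex_of_real (1 / (2 * \<parallel>z\<parallel>))"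
    have c: "cmod c = 1 / (2 * \<parallel>z\<parallel>)" "cnj c = c"
      using pos by (simp_all add: c_def norm_divide norm_mult)
    have "\<parallel>f (c \<cdot> z)\<parallel> \<le> 2"
      using z pos by (intro small) (simp_all add: star_scale c)
    then show ?thesis
      using fD(1,4)[of z] z pos by (simp add: c field_simps)
  qed
  have "\<parallel>f x\<parallel>\<^sup>2 = \<parallel>f (x\<^sup>\<star> \<boxdot> x)\<parallel>"
    using fD by (simp add: norm_star_mult)
  also have "\<dots> \<le> 4 * \<parallel>x\<^sup>\<star> \<boxdot> x\<parallel>"
    by (rule self_adjoint) (simp_all add: star_mult)
  also have "\<dots> = (2 * \<parallel>x\<parallel>)\<^sup>2"
    by (simp add: norm_star_mult power_mult_distrib)
  finally show ?thesis
    by (rule power2_le_imp_le) simp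
qed

lemma star_endo_converges:
  assumes f: "star_endo f" and X: "converges X a"
  shows "converges (\<lambda>n. f (X n)) (f a)"
proof (rule converges_by_bound[OF X])
  note fD = star_endoD[OF f]
  note [simp] = convergesD[OF X]
  show "f (X n) \<in> carrier A" "f a \<in> carrier A" for n
    by (simp_all add: fD)
  show "\<parallel>f (X n) \<boxminus> f a\<parallel> \<le> \<parallel>X n \<boxminus> a\<parallel> * 2" for n
    using star_endo_bounded[OF f, of "X n \<boxminus> a"] by (simp add: fD)
qed

end

section \<open>Generated C*-subalgebras\<close>

context cstar_algebra
begin

text \<open>To be used with sets that are defined by equations between continuous maps.\<close>
lemma cstar_subalgebraI:
  assumes B: "B \<subseteq> carrier A" "\<zero>\<^sub>s \<in> B"
    "\<And>x y. x \<in> B \<Longrightarrow> y \<in> B \<Longrightarrow> x \<boxplus> y \<in> B" "\<And>x y. x \<in> B \<Longrightarrow> y \<in> B \<Longrightarrow> x \<boxdot> y \<in> B"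
    "\<And>c x. x \<in> B \<Longrightarrow> c \<cdot> x \<in> B" "\<And>x. x \<in> B \<Longrightarrow> x\<^sup>\<star> \<in> B"
    "\<And>X a. converges X a \<Longrightarrow> (\<And>n. X n \<in> B) \<Longrightarrow> a \<in> B"
  shows "cstar_subalgebra A B"
  unfolding cstar_subalgebra_def
proof (intro conjI allI impI ballI)
  fix X a
  assume X: "\<forall>n::nat. X n \<in> B" and "a \<in> carrier A" "(\<lambda>n. sdist A (X n) a) \<longlonglongrightarrow> 0"
  then have "converges X a"
    using B(1) unfolding converges_def sdist_def by blast
  then show "a \<in> B"
    by (rule B(7)) (use X in blast)
qed (simp_all add: B)

lemma generated_subset: "cstar_subalgebra A B \<Longrightarrow> X \<subseteq> B \<Longrightarrow> cstar_generated A X \<subseteq> B"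
  by (auto simp: cstar_generated_def)

lemma subset_generated: "X \<subseteq> cstar_generated A X"
  by (auto simp: cstar_generated_def)

lemma carrier_subalgebra: "cstar_subalgebra A (carrier A)"
  by (simp add: cstar_subalgebra_def)

lemma star_endos_eq_on_generated:
  assumes f: "star_endo f" and g: "star_endo g" and X: "X \<subseteq> carrier A"
    and eq: "\<And>x. x \<in> X \<Longrightarrow> f x = g x" and d: "d \<in> cstar_generated A X"
  shows "f d = g d"
proof -
  note fD = star_endoD[OF f] and gD = star_endoD[OF g]
  let ?B = "{x \<in> carrier A. f x = g x}"
  have "cstar_subalgebra A ?B"
  proof (rule cstar_subalgebraI)
    show "\<zero>\<^sub>s \<in> ?B"
      using fD(4)[of "\<zero>\<^sub>s" 0] gD(4)[of "\<zero>\<^sub>s" 0] fD(1) gD(1) by simp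
    fix X a assume X: "converges X a" and "\<And>n. X n \<in> ?B"
    then show "a \<in> ?B"
      using converges_unique[OF star_endo_converges[OF f X]] star_endo_converges[OF g X] convergesD(2)[OF X]
      by simp
  qed (simp_all add: fD gD subset_iff)
  then have "cstar_generated A X \<subseteq> ?B"
    by (rule generated_subset) (use X eq in blast)
  then show ?thesis
    using d by blast
qed

text \<open>Self-adjointness of \<open>Y\<close> makes its commutant closed under the involution.\<close>
lemma commutant_subalgebra:
  assumes Y: "Y \<subseteq> carrier A" "\<And>y. y \<in> Y \<Longrightarrow> y\<^sup>\<star> \<in> Y"
  shows "cstar_subalgebra A {x \<in> carrier A. \<forall>y\<in>Y. x \<boxdot> y = y \<boxdot> x}" (is "cstar_subalgebra A ?B")
proof (rule cstar_subalgebraI)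
  have Yc [simp]: "y \<in> carrier A" if "y \<in> Y" for y
    using Y that by blast
  show "?B \<subseteq> carrier A" "\<zero>\<^sub>s \<in> ?B"
    by auto
  show "x \<boxplus> z \<in> ?B" if "x \<in> ?B" "z \<in> ?B" for x z
    using that by (simp add: distrib_left distrib_right)
  show "x \<boxdot> z \<in> ?B" if "x \<in> ?B" "z \<in> ?B" for x z
  proof -
    have "x \<boxdot> z \<boxdot> y = y \<boxdot> (x \<boxdot> z)" if y: "y \<in> Y" for y
    proof -
      have [simp]: "x \<in> carrier A" "z \<in> carrier A" "y \<in> carrier A"
        and comm: "x \<boxdot> y = y \<boxdot> x" "z \<boxdot> y = y \<boxdot> z"
        using \<open>x \<in> ?B\<close> \<open>z \<in> ?B\<close> y by simp_all
      have "x \<boxdot> z \<boxdot> y = x \<boxdot> y \<boxdot> z"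
        by (simp add: mult_assoc comm(2))
      also have "\<dots> = y \<boxdot> x \<boxdot> z"
        by (simp only: comm(1))
      also have "\<dots> = y \<boxdot> (x \<boxdot> z)"
        by (simp add: mult_assoc)
      finally show ?thesis .
    qed
    then show ?thesis
      using that by simp
  qed
  show "c \<cdot> x \<in> ?B" if "x \<in> ?B" for c x
    using that by simp
  show "x\<^sup>\<star> \<in> ?B" if x: "x \<in> ?B" for x
  proof -
    have "x\<^sup>\<star> \<boxdot> y = y \<boxdot> x\<^sup>\<star>" if y: "y \<in> Y" for y
    proof -
      have "x \<boxdot> y\<^sup>\<star> = y\<^sup>\<star> \<boxdot> x"
        using x Y(2)[OF y] by simp
      then have "(x \<boxdot> y\<^sup>\<star>)\<^sup>\<star> = (y\<^sup>\<star> \<boxdot> x)\<^sup>\<star>"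
        by simp
      then show ?thesis
        using x y by (simp add: star_mult)
    qed
    then show ?thesis
      using x by simp
  qed
  fix X a assume X: "converges X a" and XB: "\<And>n. X n \<in> ?B"
  have "a \<boxdot> y = y \<boxdot> a" if "y \<in> Y" for y
  proof -
    have "(\<lambda>n. X n \<boxdot> y) = (\<lambda>n. y \<boxdot> X n)"
      using XB that by auto
    then show ?thesis
      using converges_unique[OF converges_mult_right[OF X Yc[OF that]]] converges_mult_left[OF X Yc[OF that]]
      by simp
  qed
  then show "a \<in> ?B"
    using convergesD(2)[OF X] by simp
qed

lemma generated_star:
  assumes "x \<in> cstar_generated A X"
  shows "x\<^sup>\<star> \<in> cstar_generated A X"
  using assms by (auto simp: cstar_generated_def cstar_subalgebra_def)

text \<open>Pass to the commutant twice: the generated algebra commutes with its generators, so the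
  generators lie in the commutant of the generated algebra.\<close>
lemma generated_commute:
  assumes X: "X \<subseteq> carrier A" "\<And>x. x \<in> X \<Longrightarrow> x\<^sup>\<star> \<in> X"
    and comm: "\<And>x y. x \<in> X \<Longrightarrow> y \<in> X \<Longrightarrow> x \<boxdot> y = y \<boxdot> x"
    and d: "d \<in> cstar_generated A X" "d' \<in> cstar_generated A X"
  shows "d \<boxdot> d' = d' \<boxdot> d"
proof -
  let ?D = "cstar_generated A X"
  have D: "?D \<subseteq> carrier A"
    by (rule generated_subset[OF carrier_subalgebra X(1)])
  have "?D \<subseteq> {x \<in> carrier A. \<forall>y\<in>X. x \<boxdot> y = y \<boxdot> x}"
    using X comm by (intro generated_subset commutant_subalgebra) auto
  then have "X \<subseteq> {x \<in> carrier A. \<forall>y\<in>?D. x \<boxdot> y = y \<boxdot> x}"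
    using X by auto
  then have "?D \<subseteq> {x \<in> carrier A. \<forall>y\<in>?D. x \<boxdot> y = y \<boxdot> x}"
    by (intro generated_subset commutant_subalgebra D generated_star)
  then show ?thesis
    using d by blast
qed

end

section \<open>Projections and partial isometries\<close>

definition (in cstar_algebra) is_proj :: "'a \<Rightarrow> bool" where
  "is_proj q \<longleftrightarrow> q \<in> carrier A \<and> q\<^sup>\<star> = q \<and> q \<boxdot> q = q"

context cstar_algebra
begin

lemma is_projD: "is_proj q \<Longrightarrow> q \<in> carrier A" "is_proj q \<Longrightarrow> q\<^sup>\<star> = q" "is_proj q \<Longrightarrow> q \<boxdot> q = q"
  by (simp_all add: is_proj_def)

lemma star_endo_is_proj: "star_endo f \<Longrightarrow> is_proj q \<Longrightarrow> is_proj (f q)"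
  unfolding is_proj_def by (metis star_endoD(1,3,5))

lemma norm_le_1_if_isometry:
  assumes s: "s \<in> carrier A" and q: "is_proj (s\<^sup>\<star> \<boxdot> s)"
  shows "\<parallel>s\<parallel> \<le> 1"
proof -
  let ?q = "s\<^sup>\<star> \<boxdot> s"
  have "\<parallel>?q\<parallel> * \<parallel>?q\<parallel> = 1 * \<parallel>?q\<parallel>"
    using norm_star_mult[of ?q] is_projD[OF q] by (simp add: power2_eq_square)
  then have "\<parallel>?q\<parallel> \<le> 1"
    by auto
  then have "\<parallel>s\<parallel>\<^sup>2 \<le> 1\<^sup>2"
    using norm_star_mult[OF s] by simp
  then show ?thesis
    by (rule power2_le_imp_le) simp
qed

lemma norm_proj_le_1: "is_proj q \<Longrightarrow> \<parallel>q\<parallel> \<le> 1"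
  by (rule norm_le_1_if_isometry) (simp_all add: is_projD)

text \<open>Commuting projections behave like indicator functions: at distance less than 1 they agree.
  Indeed \<open>p - p q = p (p - q)\<close> is idempotent of norm less than 1, hence zero.\<close>
lemma commuting_projs_dist_less_1:
  assumes p: "is_proj p" and q: "is_proj q" and comm: "p \<boxdot> q = q \<boxdot> p" and dist: "\<parallel>p \<boxminus> q\<parallel> < 1"
  shows "p = q"
proof -
  have absorb: "r = r \<boxdot> t" if r: "is_proj r" and t: "is_proj t" and rt: "r \<boxdot> t = t \<boxdot> r" and d: "\<parallel>r \<boxminus> t\<parallel> < 1" for r t
  proof -
    note [simp] = is_projD(1)[OF r] is_projD(1)[OF t]
    let ?f = "r \<boxminus> r \<boxdot> t"
    have rrt: "r \<boxdot> (r \<boxdot> t) = r \<boxdot> t" "r \<boxdot> t \<boxdot> r = r \<boxdot> t" "(r \<boxdot> t) \<boxdot> (r \<boxdot> t) = r \<boxdot> t"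
    proof -
      show 1: "r \<boxdot> (r \<boxdot> t) = r \<boxdot> t"
        using is_projD(3)[OF r] by (simp flip: mult_assoc)
      show 2: "r \<boxdot> t \<boxdot> r = r \<boxdot> t"
      proof -
        have "r \<boxdot> t \<boxdot> r = r \<boxdot> (t \<boxdot> r)"
          by (simp add: mult_assoc)
        then show ?thesis
          by (simp only: 1 flip: rt)
      qed
      show "(r \<boxdot> t) \<boxdot> (r \<boxdot> t) = r \<boxdot> t"
        using 2 is_projD(3)[OF t] by (metis mult_assoc is_projD(1) r t mult_closed)
    qed
    have ff: "?f \<boxdot> ?f = ?f"
      using is_projD(3)[OF r] by (simp add: distrib_left distrib_right scale_add_right rrt)
    have "\<parallel>?f\<parallel> = \<parallel>r \<boxdot> (r \<boxminus> t)\<parallel>"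
      using is_projD(3)[OF r] by (simp add: distrib_left)
    also have "\<dots> \<le> \<parallel>r\<parallel> * \<parallel>r \<boxminus> t\<parallel>"
      by (rule norm_mult) simp_all
    also have "\<dots> \<le> 1 * \<parallel>r \<boxminus> t\<parallel>"
      by (intro mult_right_mono norm_proj_le_1 r) simp
    finally have f1: "\<parallel>?f\<parallel> < 1"
      using d by simp
    have "\<parallel>?f\<parallel> \<le> \<parallel>?f\<parallel> * \<parallel>?f\<parallel>"
      using norm_mult[of ?f ?f] ff by simp
    then have "\<parallel>?f\<parallel> * (1 - \<parallel>?f\<parallel>) \<le> 0"
      by (simp add: algebra_simps)
    then have "\<parallel>?f\<parallel> \<le> 0"
      using f1 by (simp add: mult_le_0_iff)
    then have "\<parallel>?f\<parallel> = 0"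
      by (intro order_antisym norm_ge_0) simp_all
    then show ?thesis
      by (intro eq_if_norm_minus_eq_0) simp_all
  qed
  have "p = p \<boxdot> q"
    by (rule absorb[OF p q comm dist])
  moreover have "q = q \<boxdot> p"
    using dist norm_minus_commute[of p q] is_projD(1)[OF p] is_projD(1)[OF q]
    by (intro absorb[OF q p comm[symmetric]]) simp
  ultimately show ?thesis
    using comm by simp
qed

text \<open>By the C*-identity, \<open>\<parallel>s - s p\<parallel>\<^sup>2 = \<parallel>p - p p - p p + p p p\<parallel> = 0\<close>.\<close>
lemma isometry_mult_support:
  assumes s [simp]: "s \<in> carrier A" and p: "is_proj p" and sp: "s\<^sup>\<star> \<boxdot> s = p"
  shows "s \<boxdot> p = s"
proof -
  note [simp] = is_projD[OF p]
  have 1: "s\<^sup>\<star> \<boxdot> (s \<boxdot> p) = p"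
    by (simp add: sp flip: mult_assoc)
  have 2: "p \<boxdot> s\<^sup>\<star> \<boxdot> s = p" "p \<boxdot> s\<^sup>\<star> \<boxdot> (s \<boxdot> p) = p"
    using 1 by (simp_all add: sp mult_assoc)
  have "(s \<boxminus> s \<boxdot> p)\<^sup>\<star> \<boxdot> (s \<boxminus> s \<boxdot> p) = \<zero>\<^sub>s"
    by (simp add: star_add star_scale star_mult distrib_left distrib_right scale_add_right 1 2 sp)
  then have "\<parallel>s \<boxminus> s \<boxdot> p\<parallel> = 0"
    using norm_star_mult[of "s \<boxminus> s \<boxdot> p"] by simp
  then show ?thesis
    by (intro eq_if_norm_minus_eq_0[symmetric]) simp_all
qed

end

section \<open>Path projections of a graph family\<close>

text \<open>A Toeplitz-Cuntz-Krieger family of the graph.\<close>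
locale graph_family = cstar_algebra A + wf_digraph E
  for A :: "'a star_alg" (structure) and E :: "('v, 'e) pre_digraph" +
  fixes P :: "'v \<Rightarrow> 'a" and S :: "'e \<Rightarrow> 'a"
  assumes P_proj: "v \<in> verts E \<Longrightarrow> is_proj (P v)"
    and P_orth: "v \<in> verts E \<Longrightarrow> w \<in> verts E \<Longrightarrow> v \<noteq> w \<Longrightarrow> P v \<boxdot> P w = \<zero>\<^sub>s"
    and S_closed [simp]: "e \<in> arcs E \<Longrightarrow> S e \<in> carrier A"
    and S_isometry: "e \<in> arcs E \<Longrightarrow> (S e)\<^sup>\<star> \<boxdot> S e = P (head E e)"
    and S_orth: "e \<in> arcs E \<Longrightarrow> f \<in> arcs E \<Longrightarrow> e \<noteq> f \<Longrightarrow> (S e)\<^sup>\<star> \<boxdot> S f = \<zero>\<^sub>s"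
    and S_range: "e \<in> arcs E \<Longrightarrow> P (tail E e) \<boxdot> (S e \<boxdot> (S e)\<^sup>\<star>) = S e \<boxdot> (S e)\<^sup>\<star>"
begin

lemma P_closed [simp]: "v \<in> verts E \<Longrightarrow> P v \<in> carrier A"
  using P_proj is_projD by blast

lemma S_head: "e \<in> arcs E \<Longrightarrow> S e \<boxdot> P (head E e) = S e"
  by (rule isometry_mult_support) (simp_all add: P_proj S_isometry)

lemma tail_S:
  assumes e: "e \<in> arcs E"
  shows "P (tail E e) \<boxdot> S e = S e"
proof -
  have "P (tail E e) \<boxdot> (S e \<boxdot> (S e)\<^sup>\<star>) \<boxdot> S e = S e \<boxdot> (S e)\<^sup>\<star> \<boxdot> S e"
    by (simp add: S_range e)
  then show ?thesis
    using e by (simp add: mult_assoc S_isometry S_head)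
qed

text \<open>Starting every path with its source vertex and ending it with the projection of its
  last vertex treats paths of length 0 and longer paths alike.\<close>
fun path_elem :: "'v \<Rightarrow> 'e list \<Rightarrow> 'a" where
  "path_elem u [] = P u"
| "path_elem u (e # \<mu>) = S e \<boxdot> path_elem (head E e) \<mu>"

definition path_proj :: "'v \<Rightarrow> 'e list \<Rightarrow> 'a" where
  "path_proj u \<mu> = path_elem u \<mu> \<boxdot> (path_elem u \<mu>)\<^sup>\<star>"

lemma awalk_Cons_iff':
  "awalk u (e # \<mu>) v \<longleftrightarrow> e \<in> arcs E \<and> u = tail E e \<and> awalk (head E e) \<mu> v"
  by (auto simp: awalk_def)

lemma path_elem_closed [simp]: "awalk u \<mu> v \<Longrightarrow> path_elem u \<mu> \<in> carrier A"
  by (induction \<mu> arbitrary: u) (auto simp: awalk_Cons_iff' awalk_def[of _ "[]"])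

lemma path_proj_closed [simp]: "awalk u \<mu> v \<Longrightarrow> path_proj u \<mu> \<in> carrier A"
  unfolding path_proj_def by simp

text \<open>The product telescopes: \<open>S\<^sub>e\<^sup>\<star> S\<^sub>e\<close> is the projection at the source of the rest of the
  path and acts on the rest as a unit.\<close>
lemma path_elem_isometry: "awalk u \<mu> v \<Longrightarrow> (path_elem u \<mu>)\<^sup>\<star> \<boxdot> path_elem u \<mu> = P v"
proof (induction \<mu> arbitrary: u)
  case Nil
  then have "u = v" "v \<in> verts E"
    by (auto simp: awalk_def)
  then show ?case
    using is_projD[OF P_proj] by simp
next
  case (Cons e \<mu>)
  have e: "e \<in> arcs E" and w: "awalk (head E e) \<mu> v"
    using Cons.prems by (auto simp: awalk_Cons_iff')
  note [simp] = path_elem_closed[OF w] e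
  have "(path_elem u (e # \<mu>))\<^sup>\<star> \<boxdot> path_elem u (e # \<mu>) =
      (path_elem (head E e) \<mu>)\<^sup>\<star> \<boxdot> ((S e)\<^sup>\<star> \<boxdot> S e \<boxdot> path_elem (head E e) \<mu>)"
    by (simp add: star_mult mult_assoc)
  moreover have "(S e)\<^sup>\<star> \<boxdot> S e \<boxdot> path_elem (head E e) \<mu> = path_elem (head E e) \<mu>"
  proof (cases \<mu>)
    case Nil
    then show ?thesis
      using is_projD(3)[OF P_proj] by (simp add: S_isometry)
  next
    case (Cons f \<nu>)
    then show ?thesis
      using w tail_S[of f] path_elem_closed[of "head E f" \<nu> v]
      by (auto simp: awalk_Cons_iff' S_isometry simp flip: mult_assoc)
  qed
  ultimately show ?case
    using Cons.IH[OF w] by simp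
qed

lemma source_path_elem:
  assumes "awalk u \<mu> v"
  shows "P u \<boxdot> path_elem u \<mu> = path_elem u \<mu>"
proof (cases \<mu>)
  case Nil
  then show ?thesis
    using assms is_projD(3)[OF P_proj] by (auto simp: awalk_def)
next
  case (Cons f \<nu>)
  then show ?thesis
    using assms tail_S[of f] path_elem_closed[of "head E f" \<nu> v]
    by (auto simp: awalk_Cons_iff' simp flip: mult_assoc)
qed

lemma path_proj_is_proj:
  assumes w: "awalk u \<mu> v"
  shows "is_proj (path_proj u \<mu>)"
proof -
  note [simp] = path_elem_closed[OF w]
  have v: "v \<in> verts E"
    using w by (rule awalk_last_in_verts)
  have "path_elem u \<mu> \<boxdot> (path_elem u \<mu>)\<^sup>\<star> \<boxdot> (path_elem u \<mu> \<boxdot> (path_elem u \<mu>)\<^sup>\<star>) =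
      path_elem u \<mu> \<boxdot> ((path_elem u \<mu>)\<^sup>\<star> \<boxdot> path_elem u \<mu>) \<boxdot> (path_elem u \<mu>)\<^sup>\<star>"
    by (simp add: mult_assoc)
  also have "\<dots> = path_elem u \<mu> \<boxdot> (path_elem u \<mu>)\<^sup>\<star>"
    using isometry_mult_support[of "path_elem u \<mu>" "P v"] path_elem_isometry[OF w] P_proj[OF v] by simp
  finally show ?thesis
    by (simp add: is_proj_def path_proj_def star_mult)
qed

lemma path_proj_Cons:
  assumes "awalk u (e # \<mu>) v"
  shows "path_proj u (e # \<mu>) = S e \<boxdot> path_proj (head E e) \<mu> \<boxdot> (S e)\<^sup>\<star>"
  using assms path_elem_closed[of "head E e" \<mu> v]
  by (simp add: path_proj_def awalk_Cons_iff' star_mult mult_assoc)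

lemma path_proj_Nil: "u \<in> verts E \<Longrightarrow> path_proj u [] = P u"
  using is_projD[OF P_proj] by (simp add: path_proj_def)

lemma P_path_proj:
  assumes w: "awalk u \<mu> v" and x: "x \<in> verts E"
  shows "P x \<boxdot> path_proj u \<mu> = (if x = u then path_proj u \<mu> else \<zero>\<^sub>s)"
proof -
  note [simp] = path_elem_closed[OF w] x
  have u [simp]: "u \<in> verts E"
    using w by (simp add: awalk_def)
  have *: "P u \<boxdot> path_proj u \<mu> = path_proj u \<mu>"
    using source_path_elem[OF w] by (simp add: path_proj_def flip: mult_assoc)
  show ?thesis
  proof (cases "x = u")
    case False
    have "P x \<boxdot> (P u \<boxdot> path_proj u \<mu>) = \<zero>\<^sub>s"
      using P_orth[OF x u False] path_proj_closed[OF w] by (simp flip: mult_assoc)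
    then show ?thesis
      using False * by simp
  qed (simp add: *)
qed

lemma path_proj_P:
  assumes w: "awalk u \<mu> v" and x: "x \<in> verts E"
  shows "path_proj u \<mu> \<boxdot> P x = P x \<boxdot> path_proj u \<mu>"
proof -
  have "(P x \<boxdot> path_proj u \<mu>)\<^sup>\<star> = P x \<boxdot> path_proj u \<mu>"
    using P_path_proj[OF w x] is_projD(2)[OF path_proj_is_proj[OF w]] by simp
  then show ?thesis
    using star_mult[OF P_closed[OF x] path_proj_closed[OF w]]
      is_projD(2)[OF path_proj_is_proj[OF w]] is_projD(2)[OF P_proj[OF x]] by simp
qed

text \<open>Either the first edges differ and both products vanish, or they agree and can be
  stripped off, because \<open>S\<^sub>e\<^sup>\<star> S\<^sub>e\<close> is a unit for the projections of paths that start at the head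
  of \<open>e\<close>.\<close>
lemma path_projs_commute:
  assumes "awalk u \<mu> v" "awalk u' \<nu> v'"
  shows "path_proj u \<mu> \<boxdot> path_proj u' \<nu> = path_proj u' \<nu> \<boxdot> path_proj u \<mu>"
  using assms
proof (induction \<mu> arbitrary: u u' \<nu>)
  case Nil
  then have u: "u \<in> verts E"
    by (auto simp: awalk_def)
  show ?case
    using path_proj_P[OF Nil.prems(2) u] by (simp add: path_proj_Nil[OF u])
next
  case (Cons e \<mu>)
  show ?case
  proof (cases \<nu>)
    case Nil
    then have u: "u' \<in> verts E"
      using Cons.prems by (auto simp: awalk_def)
    show ?thesis
      using path_proj_P[OF Cons.prems(1) u] by (simp add: Nil path_proj_Nil[OF u])
  next
    case \<nu>: (Cons f \<nu>')
    have e: "e \<in> arcs E" and \<mu>: "awalk (head E e) \<mu> v" and f: "f \<in> arcs E" and \<nu>': "awalk (head E f) \<nu>' v'"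
      using Cons.prems by (simp_all add: \<nu> awalk_Cons_iff')
    note [simp] = e f path_proj_closed[OF \<mu>] path_proj_closed[OF \<nu>']
    let ?q = "path_proj (head E e) \<mu>" and ?r = "path_proj (head E f) \<nu>'"
    have prods: "path_proj u (e # \<mu>) \<boxdot> path_proj u' (f # \<nu>') = S e \<boxdot> (?q \<boxdot> (((S e)\<^sup>\<star> \<boxdot> S f) \<boxdot> ?r)) \<boxdot> (S f)\<^sup>\<star>"
      "path_proj u' (f # \<nu>') \<boxdot> path_proj u (e # \<mu>) = S f \<boxdot> (?r \<boxdot> (((S f)\<^sup>\<star> \<boxdot> S e) \<boxdot> ?q)) \<boxdot> (S e)\<^sup>\<star>"
      using Cons.prems by (simp_all add: \<nu> path_proj_Cons mult_assoc)
    show ?thesis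
    proof (cases "e = f")
      case True
      then show ?thesis
        unfolding \<nu> prods using P_path_proj[OF \<mu>, of "head E e"] P_path_proj[OF \<nu>', of "head E e"] Cons.IH[OF \<mu> \<nu>']
        by (simp add: S_isometry)
    next
      case False
      then show ?thesis
        unfolding \<nu> prods by (simp add: S_orth)
    qed
  qed
qed

text \<open>Induction on the path, using \<open>P\<^bsub>e\<mu>\<^esub> = S\<^sub>e P\<^bsub>\<mu>\<^esub> S\<^sub>e\<^sup>\<star>\<close>. Once \<open>f\<close> and \<open>g\<close> agree on
  \<open>P\<^bsub>\<mu>\<^esub>\<close>, their values at \<open>P\<^bsub>e\<mu>\<^esub>\<close> are at distance at most \<open>2 \<parallel>f S\<^sub>e - g S\<^sub>e\<parallel> < 1\<close>,
  and they are commuting projections, hence equal. The estimate starts afresh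
  at every step, so closeness on the finitely many generators suffices for paths of all lengths.\<close>
lemma close_star_endos_agree:
  assumes f: "star_endo f" and g: "star_endo g"
    and D: "\<And>u \<mu> v. awalk u \<mu> v \<Longrightarrow> f (path_proj u \<mu>) \<in> D" "\<And>u \<mu> v. awalk u \<mu> v \<Longrightarrow> g (path_proj u \<mu>) \<in> D"
    and comm: "\<And>d d'. d \<in> D \<Longrightarrow> d' \<in> D \<Longrightarrow> d \<boxdot> d' = d' \<boxdot> d"
    and P: "\<And>v. v \<in> verts E \<Longrightarrow> \<parallel>f (P v) \<boxminus> g (P v)\<parallel> < 1"
    and S: "\<And>e. e \<in> arcs E \<Longrightarrow> \<parallel>f (S e) \<boxminus> g (S e)\<parallel> < 1/2"
    and walk: "awalk u \<mu> v"
  shows "f (path_proj u \<mu>) = g (path_proj u \<mu>)"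
proof -
  have eqI: "f (path_proj u \<mu>) = g (path_proj u \<mu>)"
    if w: "awalk u \<mu> v" and d: "\<parallel>f (path_proj u \<mu>) \<boxminus> g (path_proj u \<mu>)\<parallel> < 1" for u \<mu>
    by (rule commuting_projs_dist_less_1[OF star_endo_is_proj[OF f path_proj_is_proj[OF w]]
          star_endo_is_proj[OF g path_proj_is_proj[OF w]] comm[OF D(1)[OF w] D(2)[OF w]] d])
  show ?thesis
    using walk
  proof (induction \<mu> arbitrary: u)
    case Nil
    then have "u \<in> verts E"
      by (auto simp: awalk_def)
    then show ?case
      by (intro eqI Nil) (simp add: path_proj_Nil P)
  next
    case (Cons e \<mu>)
    have e [simp]: "e \<in> arcs E" and \<mu>: "awalk (head E e) \<mu> v"
      using Cons.prems by (simp_all add: awalk_Cons_iff')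
    note [simp] = path_proj_closed[OF \<mu>]
    note fD = star_endoD[OF f] and gD = star_endoD[OF g]
    define a b q where "a = f (S e)" and "b = g (S e)" and "q = g (path_proj (head E e) \<mu>)"
    have [simp]: "a \<in> carrier A" "b \<in> carrier A" "q \<in> carrier A"
      by (simp_all add: a_def b_def q_def fD gD)
    have norm1: "\<parallel>h (S e)\<parallel> \<le> 1" if "star_endo h" for h
    proof (rule norm_le_1_if_isometry)
      have "(h (S e))\<^sup>\<star> \<boxdot> h (S e) = h (P (head E e))"
        using star_endoD[OF that] by (simp flip: S_isometry)
      then show "is_proj ((h (S e))\<^sup>\<star> \<boxdot> h (S e))"
        using star_endo_is_proj[OF that P_proj] by simp
    qed (simp add: star_endoD[OF that])
    have a: "\<parallel>a\<parallel> \<le> 1" and b: "\<parallel>b\<parallel> \<le> 1"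
      by (simp_all add: a_def b_def norm1 f g)
    have q: "\<parallel>q\<parallel> \<le> 1"
      unfolding q_def by (intro norm_proj_le_1 star_endo_is_proj[OF g] path_proj_is_proj[OF \<mu>])
    have "a \<boxdot> q \<boxminus> b \<boxdot> q = (a \<boxminus> b) \<boxdot> q"
      by (simp add: distrib_right)
    then have aq: "\<parallel>a \<boxdot> q \<boxminus> b \<boxdot> q\<parallel> \<le> \<parallel>a \<boxminus> b\<parallel>"
      using norm_mult[of "a \<boxminus> b" q] mult_left_mono[OF q, of "\<parallel>a \<boxminus> b\<parallel>"] by simp
    have bq: "\<parallel>b \<boxdot> q\<parallel> \<le> 1"
      using norm_mult[of b q] mult_mono[OF b q] by simp
    have "a\<^sup>\<star> \<boxminus> b\<^sup>\<star> = (a \<boxminus> b)\<^sup>\<star>"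
      by (simp add: star_add star_scale)
    then have ab: "\<parallel>a\<^sup>\<star> \<boxminus> b\<^sup>\<star>\<parallel> = \<parallel>a \<boxminus> b\<parallel>"
      by simp
    have "\<parallel>a \<boxdot> q \<boxdot> a\<^sup>\<star> \<boxminus> b \<boxdot> q \<boxdot> b\<^sup>\<star>\<parallel>
        \<le> \<parallel>a \<boxdot> q \<boxminus> b \<boxdot> q\<parallel> * \<parallel>a\<^sup>\<star>\<parallel> + \<parallel>b \<boxdot> q\<parallel> * \<parallel>a\<^sup>\<star> \<boxminus> b\<^sup>\<star>\<parallel>"
      by (rule mult_diff_bound) simp_all
    also have "\<dots> \<le> \<parallel>a \<boxminus> b\<parallel> * 1 + 1 * \<parallel>a \<boxminus> b\<parallel>"
      using a aq bq ab by (intro add_mono mult_mono) simp_all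
    also have "\<dots> < 1"
      using S[OF e] by (simp add: a_def b_def)
    finally have "\<parallel>a \<boxdot> q \<boxdot> a\<^sup>\<star> \<boxminus> b \<boxdot> q \<boxdot> b\<^sup>\<star>\<parallel> < 1" .
    moreover have "f (path_proj u (e # \<mu>)) = a \<boxdot> q \<boxdot> a\<^sup>\<star>" "g (path_proj u (e # \<mu>)) = b \<boxdot> q \<boxdot> b\<^sup>\<star>"
      using Cons.IH[OF \<mu>] by (simp_all add: path_proj_Cons[OF Cons.prems] a_def b_def q_def fD gD)
    ultimately show ?case
      by (intro eqI[OF Cons.prems]) simp
  qed
qed

end

section \<open>Cosets of the automorphisms fixing a subset\<close>

context cstar_algebra
begin

lemma star_autoD:
  assumes "f \<in> star_auto A"
  shows "f \<in> Bij (carrier A)"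
    and "x \<in> carrier A \<Longrightarrow> f x \<in> carrier A"
    and "x \<in> carrier A \<Longrightarrow> y \<in> carrier A \<Longrightarrow> f (x \<boxplus> y) = f x \<boxplus> f y"
    and "x \<in> carrier A \<Longrightarrow> y \<in> carrier A \<Longrightarrow> f (x \<boxdot> y) = f x \<boxdot> f y"
    and "x \<in> carrier A \<Longrightarrow> f (c \<cdot> x) = c \<cdot> f x"
    and "x \<in> carrier A \<Longrightarrow> f (x\<^sup>\<star>) = (f x)\<^sup>\<star>"
  using assms Bij_imp_funcset[of f "carrier A"] by (auto simp: star_auto_def)

lemma star_auto_subgroup: "subgroup (star_auto A) (BijGroup (carrier A))"
proof (rule group.subgroupI[OF group_BijGroup])
  show "star_auto A \<subseteq> carrier (BijGroup (carrier A))"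
    by (auto simp: star_auto_def BijGroup_def)
  show "star_auto A \<noteq> {}"
    using id_Bij[of "carrier A"] by (auto simp: star_auto_def intro!: exI[of _ "\<lambda>x\<in>carrier A. x"])
next
  fix f assume f: "f \<in> star_auto A"
  note fD = star_autoD[OF f]
  let ?g = "\<lambda>x\<in>carrier A. inv_into (carrier A) f x"
  have bij: "bij_betw f (carrier A) (carrier A)"
    using fD(1) by (simp add: Bij_def)
  have inv: "?g (f x) = x" if "x \<in> carrier A" for x
    using that bij_betw_inv_into_left[OF bij that] fD(2) by simp
  have surj: "\<exists>x\<in>carrier A. y = f x" if "y \<in> carrier A" for y
    using that bij by (auto simp: bij_betw_def)
  have "?g (y \<boxplus> y') = ?g y \<boxplus> ?g y' \<and> ?g (y \<boxdot> y') = ?g y \<boxdot> ?g y'"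
    if "y \<in> carrier A" "y' \<in> carrier A" for y y'
    using surj[OF that(1)] surj[OF that(2)] inv fD(3,4) by (metis add_closed mult_closed)
  moreover have "?g (c \<cdot> y) = c \<cdot> ?g y" if "y \<in> carrier A" for y c
    using surj[OF that] inv fD(5) by (metis scale_closed)
  moreover have "?g (y\<^sup>\<star>) = (?g y)\<^sup>\<star>" if "y \<in> carrier A" for y
    using surj[OF that] inv fD(6) by (metis star_closed)
  moreover have "?g \<in> Bij (carrier A)"
    by (rule restrict_inv_into_Bij[OF fD(1)])
  ultimately have "?g \<in> star_auto A"
    unfolding star_auto_def by blast
  then show "inv\<^bsub>BijGroup (carrier A)\<^esub> f \<in> star_auto A"
    by (simp only: inv_BijGroup[OF fD(1)])
next
  fix f g assume f: "f \<in> star_auto A" and g: "g \<in> star_auto A"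
  have "compose (carrier A) f g \<in> star_auto A"
    using star_autoD[OF f] star_autoD[OF g] compose_Bij by (auto simp: star_auto_def compose_eq)
  then show "f \<otimes>\<^bsub>BijGroup (carrier A)\<^esub> g \<in> star_auto A"
    using star_autoD(1)[OF f] star_autoD(1)[OF g] by (simp add: BijGroup_def)
qed

lemma BijGroup_mult_apply:
  "f \<in> star_auto A \<Longrightarrow> g \<in> star_auto A \<Longrightarrow> x \<in> carrier A \<Longrightarrow> (f \<otimes>\<^bsub>BijGroup (carrier A)\<^esub> g) x = f (g x)"
  using star_autoD(1) by (simp add: BijGroup_def compose_eq)

lemma BijGroup_inv_apply:
  assumes f: "f \<in> star_auto A" and x: "x \<in> carrier A"
  shows "(inv\<^bsub>BijGroup (carrier A)\<^esub> f) (f x) = x"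
proof -
  have "bij_betw f (carrier A) (carrier A)"
    using star_autoD(1)[OF f] by (simp add: Bij_def)
  then show ?thesis
    using star_autoD(1,2)[OF f] x by (simp add: inv_BijGroup bij_betw_inv_into_left[of f])
qed

lemma Aut_fixing_subgroup:
  assumes D: "D \<subseteq> carrier A"
  shows "subgroup (Aut_fixing A D) (BijGroup (carrier A))"
proof (rule group.subgroupI[OF group_BijGroup])
  interpret S: subgroup "star_auto A" "BijGroup (carrier A)"
    by (rule star_auto_subgroup)
  show "Aut_fixing A D \<subseteq> carrier (BijGroup (carrier A))"
    using S.subset by (auto simp: Aut_fixing_def)
  have "\<one>\<^bsub>BijGroup (carrier A)\<^esub> \<in> Aut_fixing A D"
    using S.one_closed D by (auto simp: Aut_fixing_def BijGroup_def)
  then show "Aut_fixing A D \<noteq> {}"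
    by blast
  show "inv\<^bsub>BijGroup (carrier A)\<^esub> f \<in> Aut_fixing A D" if f: "f \<in> Aut_fixing A D" for f
  proof -
    have fs: "f \<in> star_auto A" and fix_D: "\<And>d. d \<in> D \<Longrightarrow> f d = d"
      using f by (auto simp: Aut_fixing_def)
    have "(inv\<^bsub>BijGroup (carrier A)\<^esub> f) d = d" if "d \<in> D" for d
      using BijGroup_inv_apply[OF fs, of d] fix_D[OF that] D that by auto
    then show ?thesis
      using S.m_inv_closed[OF fs] by (simp add: Aut_fixing_def)
  qed
  show "f \<otimes>\<^bsub>BijGroup (carrier A)\<^esub> g \<in> Aut_fixing A D"
    if f: "f \<in> Aut_fixing A D" and g: "g \<in> Aut_fixing A D" for f g
    using f g D S.m_closed by (auto simp: Aut_fixing_def BijGroup_mult_apply subset_iff)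
qed

text \<open>Since \<open>g\<close> maps \<open>D\<close> onto itself and \<open>f\<close> agrees with it there, \<open>f \<circ> inv g\<close> fixes \<open>D\<close> pointwise.\<close>
lemma Aut_fixing_coset_eq:
  assumes D: "D \<subseteq> carrier A"
    and f: "f \<in> star_auto A" and g: "g \<in> star_auto A" "g ` D = D"
    and eq: "\<And>d. d \<in> D \<Longrightarrow> f d = g d"
  shows "Aut_fixing A D #>\<^bsub>Aut_preserving A D\<^esub> f = Aut_fixing A D #>\<^bsub>Aut_preserving A D\<^esub> g"
proof -
  let ?B = "BijGroup (carrier A)"
  interpret B: group ?B
    by (rule group_BijGroup)
  interpret S: subgroup "star_auto A" ?B
    by (rule star_auto_subgroup)
  let ?h = "f \<otimes>\<^bsub>?B\<^esub> inv\<^bsub>?B\<^esub> g"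
  have gi: "inv\<^bsub>?B\<^esub> g \<in> star_auto A"
    using g S.m_inv_closed by blast
  have "?h d = d" if d: "d \<in> D" for d
  proof -
    obtain d' where d': "d' \<in> D" "d = g d'"
      using g(2) d by blast
    have mem: "d' \<in> carrier A" "d \<in> carrier A"
      using D d'(1) d by blast+
    have "?h d = f ((inv\<^bsub>?B\<^esub> g) d)"
      by (rule BijGroup_mult_apply[OF f gi mem(2)])
    also have "(inv\<^bsub>?B\<^esub> g) d = d'"
      unfolding d'(2) by (rule BijGroup_inv_apply[OF g(1) mem(1)])
    also have "f d' = d"
      unfolding d'(2) by (rule eq[OF d'(1)])
    finally show ?thesis .
  qed
  then have "?h \<in> Aut_fixing A D"
    using f gi S.m_closed by (simp add: Aut_fixing_def)
  moreover have "f = ?h \<otimes>\<^bsub>?B\<^esub> g"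
    using f g S.mem_carrier by (simp add: B.m_assoc)
  ultimately have "f \<in> Aut_fixing A D #>\<^bsub>?B\<^esub> g"
    unfolding r_coset_def by blast
  then have "Aut_fixing A D #>\<^bsub>?B\<^esub> g = Aut_fixing A D #>\<^bsub>?B\<^esub> f"
    using S.mem_carrier[OF g(1)] Aut_fixing_subgroup[OF D] by (rule B.repr_independence)
  then show ?thesis
    by (simp add: r_coset_def Aut_preserving_def)
qed

end

section \<open>The free algebra\<close>

lemma poly_mapping_eq_sum_singles:
  fixes x :: "'a \<Rightarrow>\<^sub>0 'b :: comm_monoid_add"
  shows "x = (\<Sum>w\<in>Poly_Mapping.keys x. Poly_Mapping.single w (Poly_Mapping.lookup x w))"
proof (rule poly_mapping_eqI)
  fix v
  show "Poly_Mapping.lookup x v = Poly_Mapping.lookup (\<Sum>w\<in>Poly_Mapping.keys x. Poly_Mapping.single w (Poly_Mapping.lookup x w)) v"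
    by (auto simp: lookup_sum lookup_single when_def in_keys_iff)
qed

lemma poly_mapping_additive_induct [case_names zero single add]:
  fixes x :: "'a \<Rightarrow>\<^sub>0 'b :: comm_monoid_add"
  assumes "P 0" "\<And>w c. P (Poly_Mapping.single w c)" "\<And>x y. P x \<Longrightarrow> P y \<Longrightarrow> P (x + y)"
  shows "P x"
proof -
  have "P (\<Sum>w\<in>W. Poly_Mapping.single w (Poly_Mapping.lookup x w))" if "finite W" for W
    using that by (induction W rule: finite_induct) (auto intro: assms)
  from this[of "Poly_Mapping.keys x"] show ?thesis
    by (simp flip: poly_mapping_eq_sum_singles)
qed

lemma free_scale_eq_mult: "free_scale c x = Poly_Mapping.single 0 c * x"
  by (simp add: free_scale_def mult_map_scale_conv_mult)

lemma lookup_free_scale: "Poly_Mapping.lookup (free_scale c x) w = c * Poly_Mapping.lookup x w"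
  unfolding free_scale_def by transfer (simp add: when_def)

lemma lookup_free_star: "Poly_Mapping.lookup (free_star x) w = cnj (Poly_Mapping.lookup x (word_adj w))"
  by transfer simp

lemma free_scale_add: "free_scale c (x + y) = free_scale c x + free_scale c y"
  by (simp add: free_scale_eq_mult distrib_left)

lemma free_scale_add_left: "free_scale (c + d) x = free_scale c x + free_scale d x"
  by (simp add: free_scale_eq_mult single_add distrib_right)

lemma free_scale_simps [simp]:
  "free_scale 1 x = x" "free_scale 0 x = 0" "free_scale c 0 = 0" "free_scale (-1) x = - x"
  "free_scale c (free_scale d x) = free_scale (c * d) x"
  by (rule poly_mapping_eqI; simp add: lookup_free_scale)+

lemma free_scale_diff: "free_scale c (x - y) = free_scale c x - free_scale c y"
  by (simp add: free_scale_eq_mult right_diff_distrib)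

lemma free_scale_single: "free_scale c (Poly_Mapping.single w d) = Poly_Mapping.single w (c * d)"
  by (simp add: free_scale_eq_mult mult_single)

lemma free_scale_mult_left: "free_scale c x * y = free_scale c (x * y)"
  by (simp add: free_scale_eq_mult mult.assoc)

text \<open>Scalars sit at the empty word, which commutes with every word.\<close>
lemma free_scale_mult_right: "x * free_scale c y = free_scale c (x * y)"
proof -
  have "x * Poly_Mapping.single 0 c = Poly_Mapping.single 0 c * x"
    by (induction x rule: poly_mapping_additive_induct)
      (simp_all add: mult_single distrib_left distrib_right mult.commute)
  then show ?thesis
    by (simp add: free_scale_eq_mult flip: mult.assoc)
qed

lemma free_star_add: "free_star (x + y) = free_star x + free_star y"
  by (rule poly_mapping_eqI) (simp add: lookup_free_star lookup_add)

lemma free_star_simps [simp]: "free_star 0 = 0" "free_star (free_star x) = x"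
  by (rule poly_mapping_eqI; simp add: lookup_free_star)+

lemma free_star_diff: "free_star (x - y) = free_star x - free_star y"
  by (rule poly_mapping_eqI) (simp add: lookup_free_star lookup_minus)

lemma free_star_scale: "free_star (free_scale c x) = free_scale (cnj c) (free_star x)"
  by (rule poly_mapping_eqI) (simp add: lookup_free_star lookup_free_scale)

lemma free_star_single: "free_star (Poly_Mapping.single w c) = Poly_Mapping.single (word_adj w) (cnj c)"
proof (rule poly_mapping_eqI)
  fix v
  have "w = word_adj v \<longleftrightarrow> word_adj w = v"
    by auto
  then show "Poly_Mapping.lookup (free_star (Poly_Mapping.single w c)) v =
      Poly_Mapping.lookup (Poly_Mapping.single (word_adj w) (cnj c)) v"
    by (simp add: lookup_free_star lookup_single when_def)
qed

lemma letters_plus: "letters (v + w) = letters v @ letters w"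
  by (simp add: plus_word_def)

lemma word_adj_plus: "word_adj (v + w) = word_adj w + word_adj v"
  by (simp add: word_adj_def plus_word_def)

lemma free_star_mult: "free_star (x * y) = free_star y * free_star x"
proof (induction x rule: poly_mapping_additive_induct)
  case (single w c)
  show ?case
    by (induction y rule: poly_mapping_additive_induct)
      (simp_all add: mult_single free_star_single free_star_add word_adj_plus
        distrib_left distrib_right mult.commute)
qed (simp_all add: free_star_add distrib_left distrib_right)

lemma monomial_append: "monomial (u @ v) = monomial u * monomial v"
  by (simp add: monomial_def mult_single plus_word_def)

lemma letters_word_adj: "letters (word_adj w) = rev (map (\<lambda>(g, b). (g, \<not> b)) (letters w))"
  by (simp add: word_adj_def)


lemma keys_free_star: "Poly_Mapping.keys (free_star x) = word_adj ` Poly_Mapping.keys x"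
proof -
  have "w \<in> Poly_Mapping.keys (free_star x) \<longleftrightarrow> word_adj w \<in> Poly_Mapping.keys x" for w
    by (simp add: in_keys_iff lookup_free_star)
  then have "Poly_Mapping.keys (free_star x) = word_adj -` Poly_Mapping.keys x"
    by auto
  also have "\<dots> = word_adj ` Poly_Mapping.keys x"
    by (auto intro: image_eqI[where x="word_adj _"])
  finally show ?thesis .
qed

text \<open>Closure of \<open>F\<close> makes the pointwise operations total on Cauchy sequences in \<open>F\<close>.\<close>
locale star_subalgebra =
  fixes F :: "'g free_alg set"
  assumes zero_mem [simp]: "0 \<in> F"
    and add_mem [simp]: "x \<in> F \<Longrightarrow> y \<in> F \<Longrightarrow> x + y \<in> F"
    and mult_mem [simp]: "x \<in> F \<Longrightarrow> y \<in> F \<Longrightarrow> x * y \<in> F"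
    and scale_mem [simp]: "x \<in> F \<Longrightarrow> free_scale c x \<in> F"
    and star_mem [simp]: "x \<in> F \<Longrightarrow> free_star x \<in> F"
begin

lemma uminus_mem [simp]: "x \<in> F \<Longrightarrow> - x \<in> F"
  using scale_mem[of x "-1"] by simp

lemma diff_mem [simp]: "x \<in> F \<Longrightarrow> y \<in> F \<Longrightarrow> x - y \<in> F"
  using add_mem[of x "-y"] by simp

lemma sum_mem: "(\<And>i. i \<in> I \<Longrightarrow> f i \<in> F) \<Longrightarrow> sum f I \<in> F"
  by (induction I rule: infinite_finite_induct) simp_all

end

lemma free_star_algebra_star_subalgebra: "star_subalgebra (free_star_algebra X)"
proof
  fix x y c
  assume x: "x \<in> free_star_algebra X"
  show "free_scale c x \<in> free_star_algebra X"
    using x by (auto simp: free_star_algebra_def in_keys_iff lookup_free_scale)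
  show "free_star x \<in> free_star_algebra X"
    using x by (fastforce simp: free_star_algebra_def keys_free_star letters_word_adj)
  assume y: "y \<in> free_star_algebra X"
  show "x + y \<in> free_star_algebra X"
    using x y keys_add[of x y] by (fastforce simp: free_star_algebra_def)
  show "x * y \<in> free_star_algebra X"
    using x y keys_mult[of x y] by (fastforce simp: free_star_algebra_def letters_plus)
qed (simp add: free_star_algebra_def)

text \<open>Unlike \<open>poly_mapping_additive_induct\<close>, this keeps to words with
  letters from \<open>X\<close>.\<close>
lemma free_star_algebra_induct [consumes 1, case_names zero single add]:
  assumes "x \<in> free_star_algebra X"
    and "P 0"
    and "\<And>w c. letters w \<noteq> [] \<Longrightarrow> fst ` set (letters w) \<subseteq> X \<Longrightarrow> P (Poly_Mapping.single w c)"
    and "\<And>x y. x \<in> free_star_algebra X \<Longrightarrow> y \<in> free_star_algebra X \<Longrightarrow> P x \<Longrightarrow> P y \<Longrightarrow> P (x + y)"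
  shows "P x"
proof -
  interpret star_subalgebra "free_star_algebra X"
    by (rule free_star_algebra_star_subalgebra)
  have *: "letters w \<noteq> []" "fst ` set (letters w) \<subseteq> X" if "w \<in> Poly_Mapping.keys x" for w
    using assms(1) that by (auto simp: free_star_algebra_def)
  then have mem: "Poly_Mapping.single w (Poly_Mapping.lookup x w) \<in> free_star_algebra X" if "w \<in> Poly_Mapping.keys x" for w
    using that by (auto simp: free_star_algebra_def)
  have "P (\<Sum>w\<in>W. Poly_Mapping.single w (Poly_Mapping.lookup x w))"
    if "finite W" "W \<subseteq> Poly_Mapping.keys x" for W
    using that by (induction W rule: finite_induct) (auto intro!: assms(2,3,4) * sum_mem mem)
  from this[of "Poly_Mapping.keys x"] show ?thesis
    by (simp flip: poly_mapping_eq_sum_singles)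
qed

text \<open>Over countably many generators, finite sums of words with coefficients
  in \<open>\<rat> + i\<rat>\<close> form a countable set. It is dense for every seminorm, because changing a coefficient by \<open>d\<close> moves an
  element by at most \<open>\<bar>d\<bar>\<close> times the seminorm of the word.\<close>
lemma countable_dense_free_star_algebra:
  fixes X :: "'g set"
  assumes "countable X"
  obtains C where "countable C" "C \<subseteq> free_star_algebra X"
    "\<And>N x e. cstar_seminorm (free_star_algebra X) N \<Longrightarrow> x \<in> free_star_algebra X \<Longrightarrow> e > 0 \<Longrightarrow> \<exists>c\<in>C. N (x - c) < e"
proof -
  let ?F = "free_star_algebra X"
  interpret star_subalgebra ?F
    by (rule free_star_algebra_star_subalgebra)
  define L where "L = {w :: 'g word. letters w \<noteq> [] \<and> fst ` set (letters w) \<subseteq> X}"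
  define Q where "Q = (\<lambda>(a, b). Complex (of_rat a) (of_rat b)) ` (UNIV :: (rat \<times> rat) set)"
  define S where "S = (\<lambda>(w, q). Poly_Mapping.single w q) ` (L \<times> Q)"
  define C where "C = sum_list ` lists S"
  have "L \<subseteq> Word ` lists (X \<times> UNIV)"
  proof
    fix w assume w: "w \<in> L"
    then have "letters w \<in> lists (X \<times> UNIV)"
      by (auto simp: L_def in_lists_conv_set)
    then show "w \<in> Word ` lists (X \<times> UNIV)"
      by (intro image_eqI[of _ _ "letters w"]) simp_all
  qed
  then have "countable L"
    using assms by (rule_tac countable_subset) (auto intro!: countable_image countable_lists countable_SIGMA)
  then have 1: "countable C"
    unfolding C_def S_def Q_def by (intro countable_image countable_lists countable_SIGMA) simp_all
  have S: "S \<subseteq> ?F"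
  proof
    fix s assume "s \<in> S"
    then obtain w q where "w \<in> L" "s = Poly_Mapping.single w q"
      by (auto simp: S_def)
    moreover have "Poly_Mapping.keys s \<subseteq> {w}"
      using calculation by simp
    ultimately show "s \<in> ?F"
      by (auto simp: L_def free_star_algebra_def subset_iff)
  qed
  have "sum_list xs \<in> ?F" if "xs \<in> lists S" for xs
    using that by (induction xs) (use S in auto)
  then have 2: "C \<subseteq> ?F"
    by (auto simp: C_def)
  have C_add: "c + d \<in> C" if "c \<in> C" "d \<in> C" for c d
  proof -
    from that obtain xs ys where "c = sum_list xs" "d = sum_list ys" "xs \<in> lists S" "ys \<in> lists S"
      by (auto simp: C_def)
    then show ?thesis
      unfolding C_def by (intro image_eqI[of _ _ "xs @ ys"]) auto
  qed
  have 3: "\<exists>c\<in>C. N (x - c) < e" if N: "cstar_seminorm ?F N" and "x \<in> ?F" "e > 0" for N x and e :: real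
    using that(2,3)
  proof (induction x arbitrary: e rule: free_star_algebra_induct)
    case (zero e)
    have "N 0 = 0"
      using N[unfolded cstar_seminorm_def] free_scale_simps(2)[of 0] zero_mem
      by (metis mult_zero_left norm_zero)
    moreover have "0 \<in> C"
      unfolding C_def by (intro image_eqI[of _ _ "[]"]) auto
    ultimately show ?case
      using \<open>e > 0\<close> by force
  next
    case (single w z e)
    have w: "Poly_Mapping.single w 1 \<in> ?F"
      using single by (auto simp: free_star_algebra_def)
    let ?n = "N (Poly_Mapping.single w 1)"
    have n: "?n \<ge> 0"
      using N w by (simp add: cstar_seminorm_def)
    define d where "d = e / (2 * (?n + 1))"
    have d: "d > 0"
      using n \<open>e > 0\<close> by (simp add: d_def)
    obtain a b :: rat where ab: "\<bar>Re z - of_rat a\<bar> < d" "\<bar>Im z - of_rat b\<bar> < d"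
    proof -
      obtain a where "Re z < of_rat a" "of_rat a < Re z + d"
        using of_rat_dense[of "Re z" "Re z + d"] d by auto
      moreover obtain b where "Im z < of_rat b" "of_rat b < Im z + d"
        using of_rat_dense[of "Im z" "Im z + d"] d by auto
      ultimately show ?thesis
        by (intro that[of a b]) auto
    qed
    define q where "q = Complex (of_rat a) (of_rat b)"
    have "cmod (z - q) \<le> \<bar>Re (z - q)\<bar> + \<bar>Im (z - q)\<bar>"
      by (rule cmod_le)
    also have "\<dots> < 2 * d"
      using ab by (simp add: q_def)
    finally have q: "cmod (z - q) < 2 * d" .
    have "N (Poly_Mapping.single w z - Poly_Mapping.single w q) = N (free_scale (z - q) (Poly_Mapping.single w 1))"
      by (simp add: free_scale_single single_diff)
    also have "\<dots> = cmod (z - q) * ?n"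
      using N w by (simp add: cstar_seminorm_def)
    also have "\<dots> \<le> cmod (z - q) * (?n + 1)"
      by (intro mult_left_mono) simp_all
    also have "\<dots> < 2 * d * (?n + 1)"
      using q n by (intro mult_strict_right_mono) simp_all
    also have "\<dots> = e"
    proof -
      have "?n + 1 \<noteq> 0"
        using n by simp
      then show ?thesis
        unfolding d_def by (simp add: field_simps)
    qed
    finally have "N (Poly_Mapping.single w z - Poly_Mapping.single w q) < e" .
    moreover have "Poly_Mapping.single w q \<in> S"
      unfolding S_def Q_def using single
      by (intro image_eqI[of _ _ "(w, q)"]) (auto simp: L_def q_def)
    then have "Poly_Mapping.single w q \<in> C"
      unfolding C_def by (intro image_eqI[of _ _ "[Poly_Mapping.single w q]"]) auto
    ultimately show ?case
      by blast
  next
    case (add x y e)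
    obtain c d where "c \<in> C" "d \<in> C" "N (x - c) < e / 2" "N (y - d) < e / 2"
      using add.IH[of "e / 2"] \<open>e > 0\<close> by auto
    moreover have "x - c \<in> ?F" "y - d \<in> ?F"
      using add.hyps calculation 2 by auto
    then have "N ((x - c) + (y - d)) \<le> N (x - c) + N (y - d)"
      using N unfolding cstar_seminorm_def by blast
    ultimately have "N (x + y - (c + d)) < e" "c + d \<in> C"
      by (auto simp: algebra_simps C_add)
    then show ?case
      by blast
  qed
  show ?thesis
    using 1 2 3 that by blast
qed

section \<open>The Hausdorff completion of a C*-seminorm\<close>

locale cstar_seminormed = star_subalgebra F
  for F :: "'g free_alg set" +
  fixes N :: "'g free_alg \<Rightarrow> real"
  assumes seminorm: "cstar_seminorm F N"
begin

lemma N_ge_0 [simp]: "x \<in> F \<Longrightarrow> 0 \<le> N x"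
  and N_add: "x \<in> F \<Longrightarrow> y \<in> F \<Longrightarrow> N (x + y) \<le> N x + N y"
  and N_mult: "x \<in> F \<Longrightarrow> y \<in> F \<Longrightarrow> N (x * y) \<le> N x * N y"
  and N_scale: "x \<in> F \<Longrightarrow> N (free_scale c x) = cmod c * N x"
  and N_star_mult: "x \<in> F \<Longrightarrow> N (free_star x * x) = (N x)\<^sup>2"
  using seminorm by (simp_all add: cstar_seminorm_def)

lemma N_zero [simp]: "N 0 = 0"
  using N_scale[of 0 0] by simp

lemma N_minus_commute: "x \<in> F \<Longrightarrow> y \<in> F \<Longrightarrow> N (x - y) = N (y - x)"
  using N_scale[of "x - y" "-1"] by simp

lemma N_triangle: "x \<in> F \<Longrightarrow> y \<in> F \<Longrightarrow> z \<in> F \<Longrightarrow> N (x - z) \<le> N (x - y) + N (y - z)"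
  using N_add[of "x - y" "y - z"] by simp

lemma N_abs_diff:
  assumes "x \<in> F" "y \<in> F"
  shows "\<bar>N x - N y\<bar> \<le> N (x - y)"
  using N_triangle[of x y 0] N_triangle[of y x 0] N_minus_commute[of x y] assms by simp

lemma N_star:
  assumes "x \<in> F"
  shows "N (free_star x) = N x"
proof -
  have le: "N y \<le> N (free_star y)" if "y \<in> F" for y
    using N_mult[of "free_star y" y] N_star_mult[of y] that
    by (intro le_if_square_le_mult[of "N y" "N (free_star y)"]) (simp_all add: power2_eq_square)
  show ?thesis
    using le[of x] le[of "free_star x"] assms by simp
qed

lemma N_mult_diff:
  assumes "x \<in> F" "y \<in> F" "a \<in> F" "b \<in> F"
  shows "N (x * y - a * b) \<le> N (x - a) * N y + N a * N (y - b)"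
proof -
  have "x * y - a * b = (x - a) * y + a * (y - b)"
    by (simp add: algebra_simps)
  then have "N (x * y - a * b) \<le> N ((x - a) * y) + N (a * (y - b))"
    using N_add[of "(x - a) * y" "a * (y - b)"] assms by simp
  also have "\<dots> \<le> N (x - a) * N y + N a * N (y - b)"
    using assms by (intro add_mono N_mult) simp_all
  finally show ?thesis .
qed

abbreviation Cau :: "(nat \<Rightarrow> 'g free_alg) set" where
  "Cau \<equiv> cauchy_seqs F N"

abbreviation cls :: "(nat \<Rightarrow> 'g free_alg) \<Rightarrow> (nat \<Rightarrow> 'g free_alg) set" where
  "cls \<equiv> seq_class F N"

lemma Cau_mem: "x \<in> Cau \<Longrightarrow> x n \<in> F"
  by (simp add: cauchy_seqs_def)

lemma Cau_D: "x \<in> Cau \<Longrightarrow> e > 0 \<Longrightarrow> \<exists>M. \<forall>m\<ge>M. \<forall>n\<ge>M. N (x m - x n) < e"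
  by (simp add: cauchy_seqs_def)

lemma Cau_I:
  assumes "\<And>n. x n \<in> F" "\<And>e. e > 0 \<Longrightarrow> \<exists>M. \<forall>m\<ge>M. \<forall>n\<ge>M. N (x m - x n) < e"
  shows "x \<in> Cau"
  using assms by (simp add: cauchy_seqs_def)

lemma Cau_const [simp]: "x \<in> F \<Longrightarrow> (\<lambda>_. x) \<in> Cau"
  by (simp add: cauchy_seqs_def)

lemma Cau_norm_convergent:
  assumes x: "x \<in> Cau"
  shows "convergent (\<lambda>n. N (x n))"
proof -
  have "Cauchy (\<lambda>n. N (x n))"
  proof (rule CauchyI)
    fix e :: real assume "e > 0"
    then obtain M where M: "\<forall>m\<ge>M. \<forall>n\<ge>M. N (x m - x n) < e"
      using Cau_D[OF x] by blast
    show "\<exists>M. \<forall>m\<ge>M. \<forall>n\<ge>M. norm (N (x m) - N (x n)) < e"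
      using M N_abs_diff[OF Cau_mem[OF x] Cau_mem[OF x]] by (metis le_less_trans real_norm_def)
  qed
  then show ?thesis
    by (rule Cauchy_convergent)
qed

text \<open>Multiplication is only locally Lipschitz, so bounds on Cauchy sequences are what makes it
  pass to classes.\<close>
lemma Cau_bounded:
  assumes "x \<in> Cau"
  obtains B where "B > 0" "\<And>n. N (x n) \<le> B"
proof -
  have "Bseq (\<lambda>n. N (x n))"
    using Cau_norm_convergent[OF assms] by (rule convergent_imp_Bseq)
  then obtain B where "B > 0" "\<And>n. norm (N (x n)) \<le> B"
    by (auto elim: BseqE)
  then show ?thesis
    using that by (metis abs_le_D1 real_norm_def)
qed

lemma Cau_by_bound:
  assumes "x \<in> Cau" "\<And>n. z n \<in> F" "\<And>m n. N (z m - z n) \<le> N (x m - x n) * B"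
  shows "z \<in> Cau"
proof (rule Cau_I)
  fix e :: real assume e: "e > 0"
  then obtain M where M: "\<forall>m\<ge>M. \<forall>n\<ge>M. N (x m - x n) < e / (\<bar>B\<bar> + 1)"
    using Cau_D[OF assms(1), of "e / (\<bar>B\<bar> + 1)"] by auto
  have "N (z m - z n) < e" if "m \<ge> M" "n \<ge> M" for m n
  proof -
    have "N (x m - x n) * B \<le> N (x m - x n) * (\<bar>B\<bar> + 1)"
      using assms(1) by (intro mult_left_mono) (simp_all add: Cau_mem)
    also have "\<dots> < e"
      using M that by (simp add: pos_less_divide_eq)
    finally show ?thesis
      using assms(3)[of m n] by simp
  qed
  then show "\<exists>M. \<forall>m\<ge>M. \<forall>n\<ge>M. N (z m - z n) < e"
    by blast
qed (use assms in simp)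

lemma Cau_add:
  assumes "x \<in> Cau" "y \<in> Cau"
  shows "(\<lambda>n. x n + y n) \<in> Cau"
proof (rule Cau_I)
  fix e :: real assume "e > 0"
  then obtain M L where M: "\<forall>m\<ge>M. \<forall>n\<ge>M. N (x m - x n) < e / 2"
    and L: "\<forall>m\<ge>L. \<forall>n\<ge>L. N (y m - y n) < e / 2"
    using Cau_D[OF assms(1), of "e/2"] Cau_D[OF assms(2), of "e/2"] by auto
  have "N (x m + y m - (x n + y n)) < e" if "m \<ge> max M L" "n \<ge> max M L" for m n
  proof -
    have "N (x m + y m - (x n + y n)) \<le> N (x m - x n) + N (y m - y n)"
      using N_add[of "x m - x n" "y m - y n"] Cau_mem assms by (simp add: algebra_simps)
    moreover have "N (x m - x n) < e / 2" "N (y m - y n) < e / 2"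
      using M L that by auto
    ultimately show ?thesis
      by simp
  qed
  then show "\<exists>M. \<forall>m\<ge>M. \<forall>n\<ge>M. N (x m + y m - (x n + y n)) < e"
    by blast
qed (use assms Cau_mem in simp)

lemma Cau_scale: "x \<in> Cau \<Longrightarrow> (\<lambda>n. free_scale c (x n)) \<in> Cau"
  by (rule Cau_by_bound[of x _ "cmod c"]) (simp_all add: Cau_mem N_scale mult.commute flip: free_scale_diff)

lemma Cau_star: "x \<in> Cau \<Longrightarrow> (\<lambda>n. free_star (x n)) \<in> Cau"
  by (rule Cau_by_bound[of x _ 1]) (simp_all add: Cau_mem N_star flip: free_star_diff)

lemma Cau_mult:
  assumes x: "x \<in> Cau" and y: "y \<in> Cau"
  shows "(\<lambda>n. x n * y n) \<in> Cau"
proof (rule Cau_I)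
  fix e :: real assume e: "e > 0"
  obtain B C where B: "B > 0" "\<And>n. N (x n) \<le> B" and C: "C > 0" "\<And>n. N (y n) \<le> C"
    using Cau_bounded[OF x] Cau_bounded[OF y] by metis
  obtain M L where M: "\<forall>m\<ge>M. \<forall>n\<ge>M. N (x m - x n) < e / (2 * C)"
    and L: "\<forall>m\<ge>L. \<forall>n\<ge>L. N (y m - y n) < e / (2 * B)"
    using Cau_D[OF x, of "e/(2*C)"] Cau_D[OF y, of "e/(2*B)"] e B C by auto
  have "N (x m * y m - x n * y n) < e" if "m \<ge> max M L" "n \<ge> max M L" for m n
  proof -
    have "N (x m * y m - x n * y n) \<le> N (x m - x n) * N (y m) + N (x n) * N (y m - y n)"
      using assms by (intro N_mult_diff) (simp_all add: Cau_mem)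
    also have "\<dots> \<le> N (x m - x n) * C + B * N (y m - y n)"
      using assms B C by (intro add_mono mult_left_mono mult_right_mono) (simp_all add: Cau_mem)
    also have "\<dots> < e / (2 * C) * C + B * (e / (2 * B))"
      using M L that B C by (intro add_strict_mono mult_strict_left_mono mult_strict_right_mono) auto
    also have "\<dots> = e"
      using B C by simp
    finally show ?thesis .
  qed
  then show "\<exists>M. \<forall>m\<ge>M. \<forall>n\<ge>M. N (x m * y m - x n * y n) < e"
    by blast
qed (use assms Cau_mem in simp)

lemma cls_eq_iff:
  assumes x: "x \<in> Cau" and y: "y \<in> Cau"
  shows "cls x = cls y \<longleftrightarrow> (\<lambda>n. N (x n - y n)) \<longlonglongrightarrow> 0"
proof
  assume "cls x = cls y"
  moreover have "y \<in> cls y"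
    using y by (simp add: seq_class_def)
  ultimately have "y \<in> cls x"
    by simp
  then show "(\<lambda>n. N (x n - y n)) \<longlonglongrightarrow> 0"
    by (simp add: seq_class_def)
next
  have sub: "z \<in> cls v" if lim: "(\<lambda>n. N (u n - v n)) \<longlonglongrightarrow> 0" and uv: "u \<in> Cau" "v \<in> Cau" and z: "z \<in> cls u" for u v z
  proof -
    have z: "z \<in> Cau" "(\<lambda>n. N (u n - z n)) \<longlonglongrightarrow> 0"
      using z by (simp_all add: seq_class_def)
    have "(\<lambda>n. N (u n - v n) + N (u n - z n)) \<longlonglongrightarrow> 0"
      using tendsto_add[OF lim z(2)] by simp
    then have "(\<lambda>n. N (v n - z n)) \<longlonglongrightarrow> 0"
    proof (rule null_comparison)
      fix n
      show "abs (N (v n - z n)) \<le> N (u n - v n) + N (u n - z n)"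
        using N_triangle[of "v n" "u n" "z n"] N_minus_commute[of "u n" "v n"] uv z by (simp add: Cau_mem)
    qed
    then show ?thesis
      using z by (simp add: seq_class_def)
  qed
  assume lim: "(\<lambda>n. N (x n - y n)) \<longlonglongrightarrow> 0"
  moreover have "(\<lambda>n. N (y n - x n)) \<longlonglongrightarrow> 0"
    using lim x y by (simp add: N_minus_commute[of "x _"] Cau_mem)
  ultimately show "cls x = cls y"
    using sub x y by blast
qed

lemma cls_self: "x \<in> Cau \<Longrightarrow> x \<in> cls x"
  by (simp add: seq_class_def)

lemma cls_memD: "x' \<in> cls x \<Longrightarrow> x' \<in> Cau" "x' \<in> cls x \<Longrightarrow> (\<lambda>n. N (x n - x' n)) \<longlonglongrightarrow> 0"
  by (simp_all add: seq_class_def)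

lemma cls_eqI_bound:
  assumes "x \<in> Cau" "y \<in> Cau" "g \<longlonglongrightarrow> 0" "\<And>n. N (x n - y n) \<le> g n"
  shows "cls x = cls y"
proof -
  have "(\<lambda>n. N (x n - y n)) \<longlonglongrightarrow> 0"
    by (rule null_comparison[OF assms(3)]) (use assms in \<open>simp add: Cau_mem\<close>)
  then show ?thesis
    using assms by (simp add: cls_eq_iff)
qed

abbreviation completed :: "(nat \<Rightarrow> 'g free_alg) set star_alg" where
  "completed \<equiv> completion F N"

lemma carrier_completion: "carrier completed = cls ` Cau"
  by (simp add: completion_def)

lemma cls_closed [simp]: "x \<in> Cau \<Longrightarrow> cls x \<in> carrier completed"
  by (simp add: carrier_completion)

lemma UN_UN_const: "a \<noteq> {} \<Longrightarrow> b \<noteq> {} \<Longrightarrow> (\<And>x y. x \<in> a \<Longrightarrow> y \<in> b \<Longrightarrow> f x y = c) \<Longrightarrow> (\<Union>x\<in>a. \<Union>y\<in>b. f x y) = c"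
  by auto

lemma UN_const: "a \<noteq> {} \<Longrightarrow> (\<And>x. x \<in> a \<Longrightarrow> f x = c) \<Longrightarrow> (\<Union>x\<in>a. f x) = c"
  by auto

lemma sadd_cls [simp]:
  assumes x: "x \<in> Cau" and y: "y \<in> Cau"
  shows "sadd completed (cls x) (cls y) = cls (\<lambda>n. x n + y n)"
proof -
  have *: "cls (\<lambda>n. x' n + y' n) = cls (\<lambda>n. x n + y n)" if x': "x' \<in> cls x" and y': "y' \<in> cls y" for x' y'
  proof (rule cls_eqI_bound[symmetric])
    show "(\<lambda>n. N (x n - x' n) + N (y n - y' n)) \<longlonglongrightarrow> 0"
      using tendsto_add[OF cls_memD(2)[OF x'] cls_memD(2)[OF y']] by simp
    show "N (x n + y n - (x' n + y' n)) \<le> N (x n - x' n) + N (y n - y' n)" for n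
      using N_add[of "x n - x' n" "y n - y' n"] cls_memD(1)[OF x'] cls_memD(1)[OF y'] x y
      by (simp add: Cau_mem algebra_simps)
  qed (simp_all add: x y cls_memD(1)[OF x'] cls_memD(1)[OF y'] Cau_add)
  show ?thesis
    unfolding completion_def star_alg.simps using cls_self[OF x] cls_self[OF y]
    by (intro UN_UN_const *) auto
qed

lemma smult_cls [simp]:
  assumes x: "x \<in> Cau" and y: "y \<in> Cau"
  shows "smult completed (cls x) (cls y) = cls (\<lambda>n. x n * y n)"
proof -
  have *: "cls (\<lambda>n. x' n * y' n) = cls (\<lambda>n. x n * y n)" if x': "x' \<in> cls x" and y': "y' \<in> cls y" for x' y'
  proof -
    obtain B C where B: "B > 0" "\<And>n. N (x' n) \<le> B" and C: "C > 0" "\<And>n. N (y n) \<le> C"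
      using Cau_bounded[OF cls_memD(1)[OF x']] Cau_bounded[OF y] by metis
    note mem = Cau_mem[OF x] Cau_mem[OF y] Cau_mem[OF cls_memD(1)[OF x']] Cau_mem[OF cls_memD(1)[OF y']]
    have "cls (\<lambda>n. x n * y n) = cls (\<lambda>n. x' n * y' n)"
    proof (rule cls_eqI_bound)
      show "(\<lambda>n. N (x n - x' n) * C + B * N (y n - y' n)) \<longlonglongrightarrow> 0"
        using tendsto_add[OF tendsto_mult_left_zero[OF cls_memD(2)[OF x']] tendsto_mult_right_zero[OF cls_memD(2)[OF y']]] by simp
      show "N (x n * y n - x' n * y' n) \<le> N (x n - x' n) * C + B * N (y n - y' n)" for n
      proof -
        have "N (x n * y n - x' n * y' n) \<le> N (x n - x' n) * N (y n) + N (x' n) * N (y n - y' n)"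
          using mem by (intro N_mult_diff)
        also have "\<dots> \<le> N (x n - x' n) * C + B * N (y n - y' n)"
          using B C mem by (intro add_mono mult_left_mono mult_right_mono) simp_all
        finally show ?thesis .
      qed
    qed (simp_all add: x y cls_memD(1)[OF x'] cls_memD(1)[OF y'] Cau_mult)
    then show ?thesis ..
  qed
  show ?thesis
    unfolding completion_def star_alg.simps using cls_self[OF x] cls_self[OF y]
    by (intro UN_UN_const *) auto
qed

lemma sscale_cls [simp]:
  assumes x: "x \<in> Cau"
  shows "sscale completed c (cls x) = cls (\<lambda>n. free_scale c (x n))"
proof -
  have *: "cls (\<lambda>n. free_scale c (x' n)) = cls (\<lambda>n. free_scale c (x n))" if x': "x' \<in> cls x" for x'
  proof (rule cls_eqI_bound[symmetric])
    show "(\<lambda>n. cmod c * N (x n - x' n)) \<longlonglongrightarrow> 0"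
      using tendsto_mult_right_zero[OF cls_memD(2)[OF x']] by simp
    show "N (free_scale c (x n) - free_scale c (x' n)) \<le> cmod c * N (x n - x' n)" for n
      using cls_memD(1)[OF x'] x by (simp add: Cau_mem N_scale flip: free_scale_diff)
  qed (simp_all add: x cls_memD(1)[OF x'] Cau_scale)
  show ?thesis
    unfolding completion_def star_alg.simps using cls_self[OF x] by (intro UN_const *) auto
qed

lemma sstar_cls [simp]:
  assumes x: "x \<in> Cau"
  shows "sstar completed (cls x) = cls (\<lambda>n. free_star (x n))"
proof -
  have *: "cls (\<lambda>n. free_star (x' n)) = cls (\<lambda>n. free_star (x n))" if x': "x' \<in> cls x" for x'
  proof (rule cls_eqI_bound[symmetric])
    show "(\<lambda>n. N (x n - x' n)) \<longlonglongrightarrow> 0"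
      by (rule cls_memD(2)[OF x'])
    show "N (free_star (x n) - free_star (x' n)) \<le> N (x n - x' n)" for n
      using cls_memD(1)[OF x'] x by (simp add: Cau_mem N_star flip: free_star_diff)
  qed (simp_all add: x cls_memD(1)[OF x'] Cau_star)
  show ?thesis
    unfolding completion_def star_alg.simps using cls_self[OF x] by (intro UN_const *) auto
qed

lemma szero_completion: "szero completed = cls (\<lambda>_. 0)"
  by (simp add: completion_def)

lemma snorm_cls:
  assumes x: "x \<in> Cau"
  shows "(\<lambda>n. N (x n)) \<longlonglongrightarrow> snorm completed (cls x)"
proof -
  obtain l where l: "(\<lambda>n. N (x n)) \<longlonglongrightarrow> l"
    using Cau_norm_convergent[OF x] by (auto simp: convergent_def)
  have all: "(\<lambda>n. N (y n)) \<longlonglongrightarrow> l" if y: "y \<in> cls x" for y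
  proof -
    have "(\<lambda>n. N (y n) - N (x n)) \<longlonglongrightarrow> 0"
    proof (rule null_comparison[OF cls_memD(2)[OF y]])
      fix n show "abs (N (y n) - N (x n)) \<le> N (x n - y n)"
        using N_abs_diff[of "x n" "y n"] cls_memD(1)[OF y] x by (simp add: Cau_mem)
    qed
    then show ?thesis
      using tendsto_add[OF _ l] by fastforce
  qed
  have "(THE l. \<forall>y\<in>cls x. (\<lambda>n. N (y n)) \<longlonglongrightarrow> l) = l"
    using all cls_self[OF x] by (intro the_equality) (auto intro: LIMSEQ_unique l)
  then show ?thesis
    using l by (simp add: completion_def)
qed

lemma snorm_cls_const [simp]: "x \<in> F \<Longrightarrow> snorm completed (cls (\<lambda>_. x)) = N x"
  by (rule LIMSEQ_unique[OF snorm_cls[OF Cau_const] tendsto_const])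

lemma sdist_cls [simp]:
  assumes "x \<in> Cau" "y \<in> Cau"
  shows "sdist completed (cls x) (cls y) = snorm completed (cls (\<lambda>n. x n - y n))"
  using assms sadd_cls[OF assms(1) Cau_scale[OF assms(2), of "-1"]] by (simp add: sdist_def)

lemma Cau_diff: "x \<in> Cau \<Longrightarrow> y \<in> Cau \<Longrightarrow> (\<lambda>n. x n - y n) \<in> Cau"
  using Cau_add[of x "\<lambda>n. free_scale (-1) (y n)"] Cau_scale[of y "-1"] by simp

lemma completion_dense:
  assumes "a \<in> carrier completed" "e > 0"
  shows "\<exists>x\<in>F. sdist completed a (cls (\<lambda>_. x)) < e"
proof -
  obtain x where x: "x \<in> Cau" "a = cls x"
    using assms by (auto simp: carrier_completion)
  obtain M where M: "\<forall>m\<ge>M. \<forall>n\<ge>M. N (x m - x n) < e / 2"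
    using Cau_D[OF x(1), of "e/2"] assms by auto
  have d: "(\<lambda>n. x n - x M) \<in> Cau"
    using x by (intro Cau_diff) (simp_all add: Cau_mem)
  have "snorm completed (cls (\<lambda>n. x n - x M)) \<le> e / 2"
    by (rule LIMSEQ_le_const2[OF snorm_cls[OF d]]) (use M in \<open>auto intro!: exI[of _ M] less_imp_le\<close>)
  then have "sdist completed a (cls (\<lambda>_. x M)) < e"
    using x assms by (simp add: Cau_mem)
  then show ?thesis
    using x Cau_mem by blast
qed

text \<open>A Cauchy sequence of classes is approximated by constant classes ever more closely; the
  sequence of their representatives in \<open>F\<close> is Cauchy, and its class is the limit. The metric axioms enter
  as hypotheses because this is a step towards \<open>completion_cstar_algebra\<close>.\<close>
lemma completion_complete:
  assumes X: "\<And>n. X n \<in> carrier completed"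
    and cau: "\<And>e. e > 0 \<Longrightarrow> \<exists>M. \<forall>m\<ge>M. \<forall>n\<ge>M. sdist completed (X m) (X n) < e"
    and triangle: "\<And>a b c. a \<in> carrier completed \<Longrightarrow> b \<in> carrier completed \<Longrightarrow> c \<in> carrier completed \<Longrightarrow>
      sdist completed a c \<le> sdist completed a b + sdist completed b c"
    and sym: "\<And>a b. a \<in> carrier completed \<Longrightarrow> b \<in> carrier completed \<Longrightarrow> sdist completed a b = sdist completed b a"
  shows "\<exists>a\<in>carrier completed. (\<lambda>n. sdist completed (X n) a) \<longlonglongrightarrow> 0"
proof -
  have "\<forall>n. \<exists>x\<in>F. sdist completed (X n) (cls (\<lambda>_. x)) < 1 / Suc n"
    using completion_dense[OF X] by simp
  then obtain z where zF: "\<And>n. z n \<in> F" and z: "\<And>n. sdist completed (X n) (cls (\<lambda>_. z n)) < 1 / Suc n"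
    by metis
  have inv_lim: "(\<lambda>n. 1 / real (Suc n)) \<longlonglongrightarrow> 0"
    using LIMSEQ_inverse_real_of_nat by (simp add: inverse_eq_divide)
  have zz: "N (z m - z n) < 1 / Suc m + sdist completed (X m) (X n) + 1 / Suc n" for m n
  proof -
    have "N (z m - z n) = sdist completed (cls (\<lambda>_. z m)) (cls (\<lambda>_. z n))"
      using zF by simp
    also have "\<dots> \<le> sdist completed (cls (\<lambda>_. z m)) (X m) + (sdist completed (X m) (X n) + sdist completed (X n) (cls (\<lambda>_. z n)))"
      using triangle[of "cls (\<lambda>_. z m)" "X m" "cls (\<lambda>_. z n)"] triangle[of "X m" "X n" "cls (\<lambda>_. z n)"] X zF
      by (simp del: sdist_cls)
    finally show ?thesis
      using z[of m] z[of n] sym[of "cls (\<lambda>_. z m)" "X m"] X zF by (simp del: sdist_cls)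
  qed
  have zC: "z \<in> Cau"
  proof (rule Cau_I[OF zF])
    fix e :: real assume e: "e > 0"
    obtain M where M: "\<forall>m\<ge>M. \<forall>n\<ge>M. sdist completed (X m) (X n) < e / 3"
      using cau[of "e / 3"] e by auto
    obtain L where L: "\<forall>n\<ge>L. 1 / real (Suc n) < e / 3"
      using order_tendstoD(2)[OF inv_lim, of "e / 3"] e by (auto simp: eventually_sequentially)
    have "N (z m - z n) < e" if "m \<ge> max M L" "n \<ge> max M L" for m n
    proof -
      have "1 / Suc m < e / 3" "1 / Suc n < e / 3" "sdist completed (X m) (X n) < e / 3"
        using M L that by auto
      then show ?thesis
        using zz[of m n] by simp
    qed
    then show "\<exists>M. \<forall>m\<ge>M. \<forall>n\<ge>M. N (z m - z n) < e"
      by blast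
  qed
  have "(\<lambda>n. sdist completed (X n) (cls z)) \<longlonglongrightarrow> 0"
  proof (rule LIMSEQ_I)
    fix e :: real assume e: "e > 0"
    obtain M where M: "\<forall>m\<ge>M. \<forall>n\<ge>M. N (z m - z n) < e / 3"
      using Cau_D[OF zC, of "e / 3"] e by auto
    obtain L where L: "\<forall>n\<ge>L. 1 / real (Suc n) < e / 3"
      using order_tendstoD(2)[OF inv_lim, of "e / 3"] e by (auto simp: eventually_sequentially)
    have "norm (sdist completed (X n) (cls z) - 0) < e" if n: "n \<ge> max M L" for n
    proof -
      have d: "(\<lambda>k. z n - z k) \<in> Cau"
        using zC zF by (intro Cau_diff) simp_all
      have "snorm completed (cls (\<lambda>k. z n - z k)) \<le> e / 3"
        by (rule LIMSEQ_le_const2[OF snorm_cls[OF d]]) (use M n in \<open>auto intro!: exI[of _ M] less_imp_le\<close>)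
      then have "sdist completed (X n) (cls z) < 1 / Suc n + e / 3"
        using triangle[of "X n" "cls (\<lambda>_. z n)" "cls z"] z[of n] X zF zC by simp
      moreover have "1 / Suc n < e / 3"
        using L n by auto
      moreover have "0 \<le> sdist completed (X n) (cls z)"
        using triangle[of "cls z" "X n" "cls z"] sym[of "X n" "cls z"] X[of n] zC
          snorm_cls_const[of 0] by simp
      ultimately show ?thesis
        using e by simp
    qed
    then show "\<exists>no. \<forall>n\<ge>no. norm (sdist completed (X n) (cls z) - 0) < e"
      by blast
  qed
  then show ?thesis
    using zC by auto
qed

lemma completion_cstar_algebra: "cstar_algebra completed"
proof -
  note simps = carrier_completion Cau_add Cau_mult Cau_scale Cau_star szero_completion Cau_mem
  note triv = algebra_simps free_scale_add free_scale_add_left free_scale_mult_left free_scale_mult_right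
    free_star_add free_star_mult free_star_scale
  have rep: thesis if "a \<in> carrier completed" "\<And>x. x \<in> Cau \<Longrightarrow> a = cls x \<Longrightarrow> thesis" for a thesis
    using that by (auto simp: carrier_completion)
  have ge0: "0 \<le> snorm completed a" if "a \<in> carrier completed" for a
    using that by (rule rep) (auto intro!: LIMSEQ_le_const[OF snorm_cls] exI[of _ 0] simp: Cau_mem)
  have tri: "snorm completed (sadd completed a b) \<le> snorm completed a + snorm completed b"
    if a: "a \<in> carrier completed" and b: "b \<in> carrier completed" for a b
  proof -
    obtain x y where x: "x \<in> Cau" "a = cls x" and y: "y \<in> Cau" "b = cls y"
      using rep[OF a] rep[OF b] by metis
    have "snorm completed (cls (\<lambda>n. x n + y n)) \<le> snorm completed (cls x) + snorm completed (cls y)"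
      by (rule LIMSEQ_le[OF snorm_cls[OF Cau_add] tendsto_add[OF snorm_cls snorm_cls]])
        (use x y N_add Cau_mem in auto)
    then show ?thesis
      using x y by simp
  qed
  have scale: "snorm completed (sscale completed c a) = cmod c * snorm completed a" if a: "a \<in> carrier completed" for a c
  proof -
    obtain x where x: "x \<in> Cau" "a = cls x"
      using rep[OF a] by metis
    have "(\<lambda>n. N (free_scale c (x n))) \<longlonglongrightarrow> cmod c * snorm completed (cls x)"
      using tendsto_mult_left[OF snorm_cls[OF x(1)], of "cmod c"] x by (simp add: N_scale Cau_mem)
    then show ?thesis
      using x LIMSEQ_unique[OF snorm_cls[OF Cau_scale[OF x(1)]]] by simp
  qed
  show ?thesis
  proof
    show "szero completed \<in> carrier completed"
      by (simp add: simps)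
    fix a assume a: "a \<in> carrier completed"
    obtain x where x: "x \<in> Cau" "a = cls x"
      using rep[OF a] by metis
    fix c d :: complex
    show "sscale completed c a \<in> carrier completed" "sstar completed a \<in> carrier completed" "sadd completed a (szero completed) = a"
      "sscale completed 1 a = a" "sscale completed 0 a = szero completed"
      "sscale completed c (sscale completed d a) = sscale completed (c * d) a"
      "sscale completed (c + d) a = sadd completed (sscale completed c a) (sscale completed d a)"
      "sstar completed (sscale completed c a) = sscale completed (cnj c) (sstar completed a)"
      "sstar completed (sstar completed a) = a"
      using x by (simp_all add: Cau_scale Cau_star szero_completion triv)
    show "0 \<le> snorm completed a" "snorm completed (sscale completed c a) = cmod c * snorm completed a"
      using a by (simp_all add: ge0 scale)
    show "snorm completed (smult completed (sstar completed a) a) = (snorm completed a)\<^sup>2"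
    proof -
      have "(\<lambda>n. N (free_star (x n) * x n)) \<longlonglongrightarrow> (snorm completed (cls x))\<^sup>2"
        using tendsto_power[OF snorm_cls[OF x(1)], of 2] x by (simp add: N_star_mult Cau_mem)
      then show ?thesis
        using x LIMSEQ_unique[OF snorm_cls[OF Cau_mult[OF Cau_star[OF x(1)] x(1)]]] by (simp add: Cau_star)
    qed
    show "a = szero completed" if "snorm completed a = 0"
      using that snorm_cls[OF x(1)] x by (simp add: szero_completion cls_eq_iff)
    fix b assume b: "b \<in> carrier completed"
    obtain y where y: "y \<in> Cau" "b = cls y"
      using rep[OF b] by metis
    show "sadd completed a b \<in> carrier completed" "smult completed a b \<in> carrier completed" "sadd completed a b = sadd completed b a"
      "sscale completed c (sadd completed a b) = sadd completed (sscale completed c a) (sscale completed c b)"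
      "smult completed (sscale completed c a) b = sscale completed c (smult completed a b)"
      "smult completed a (sscale completed c b) = sscale completed c (smult completed a b)"
      "sstar completed (sadd completed a b) = sadd completed (sstar completed a) (sstar completed b)"
      "sstar completed (smult completed a b) = smult completed (sstar completed b) (sstar completed a)"
      using x y by (simp_all add: Cau_add Cau_mult Cau_scale Cau_star triv)
    show "snorm completed (sadd completed a b) \<le> snorm completed a + snorm completed b"
      by (rule tri[OF a b])
    show "snorm completed (smult completed a b) \<le> snorm completed a * snorm completed b"
    proof -
      have "snorm completed (cls (\<lambda>n. x n * y n)) \<le> snorm completed (cls x) * snorm completed (cls y)"
        by (rule LIMSEQ_le[OF snorm_cls[OF Cau_mult] tendsto_mult[OF snorm_cls snorm_cls]])
          (use x y N_mult Cau_mem in auto)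
      then show ?thesis
        using x y by simp
    qed
    fix c' assume c': "c' \<in> carrier completed"
    obtain z where z: "z \<in> Cau" "c' = cls z"
      using rep[OF c'] by metis
    show "sadd completed (sadd completed a b) c' = sadd completed a (sadd completed b c')"
      "smult completed (smult completed a b) c' = smult completed a (smult completed b c')"
      "smult completed (sadd completed a b) c' = sadd completed (smult completed a c') (smult completed b c')"
      "smult completed c' (sadd completed a b) = sadd completed (smult completed c' a) (smult completed c' b)"
      using x y z by (simp_all add: Cau_add Cau_mult triv)
  next
    fix X :: "nat \<Rightarrow> (nat \<Rightarrow> 'g free_alg) set"
    assume X: "\<And>n. X n \<in> carrier completed"
      and cau: "\<And>e. e > 0 \<Longrightarrow> \<exists>M. \<forall>m\<ge>M. \<forall>n\<ge>M. sdist completed (X m) (X n) < e"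
    show "\<exists>a\<in>carrier completed. (\<lambda>n. sdist completed (X n) a) \<longlonglongrightarrow> 0"
    proof (rule completion_complete[OF X cau])
      fix a b c assume a: "a \<in> carrier completed" and b: "b \<in> carrier completed"
      obtain x y where xy: "x \<in> Cau" "a = cls x" "y \<in> Cau" "b = cls y"
        using rep[OF a] rep[OF b] by metis
      have "snorm completed (cls (\<lambda>n. y n - x n)) = snorm completed (cls (\<lambda>n. x n - y n))"
        using scale[of "cls (\<lambda>n. x n - y n)" "-1"] xy by (simp add: Cau_diff)
      then show "sdist completed a b = sdist completed b a"
        using xy by simp
      assume c: "c \<in> carrier completed"
      obtain z where z: "z \<in> Cau" "c = cls z"
        using rep[OF c] by metis
      show "sdist completed a c \<le> sdist completed a b + sdist completed b c"
        using tri[of "cls (\<lambda>n. x n - y n)" "cls (\<lambda>n. y n - z n)"] xy z by (simp add: Cau_diff)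
    qed
  qed
qed

end

section \<open>The supremum of the C*-seminorms\<close>

lemma (in cstar_seminormed) N_monomial_le_1:
  assumes F: "F = free_star_algebra X"
    and gen: "\<And>g. g \<in> X \<Longrightarrow> N (monomial [(g, False)]) \<le> 1"
    and ls: "ls \<noteq> []" "fst ` set ls \<subseteq> X"
  shows "N (monomial ls) \<le> 1"
proof -
  have mem: "monomial us \<in> F" if "us \<noteq> []" "fst ` set us \<subseteq> X" for us
    using that by (auto simp: F monomial_def free_star_algebra_def)
  have letter: "N (monomial [l]) \<le> 1" if "fst l \<in> X" for l
  proof (cases l)
    case (Pair g b)
    have "monomial [(g, True)] = free_star (monomial [(g, False)])"
      by (simp add: monomial_def free_star_single word_adj_def)
    then have "N (monomial [(g, True)]) = N (monomial [(g, False)])"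
      using that Pair mem[of "[(g, False)]"] N_star by simp
    then show ?thesis
      using gen[of g] that Pair by (cases b) simp_all
  qed
  show ?thesis
    using ls
  proof (induction ls rule: list_nonempty_induct)
    case (single l)
    then show ?case
      by (intro letter) simp
  next
    case (cons l ls)
    have "monomial (l # ls) = monomial [l] * monomial ls"
      using monomial_append[of "[l]" ls] by simp
    then have "N (monomial (l # ls)) \<le> N (monomial [l]) * N (monomial ls)"
      using cons by (auto intro!: N_mult mem)
    also have "\<dots> \<le> 1 * 1"
      using cons mem[of ls] by (intro mult_mono letter) auto
    finally show ?case
      by simp
  qed
qed

abbreviation rel_seminorms :: "'g set \<Rightarrow> 'g free_alg set \<Rightarrow> ('g free_alg \<Rightarrow> real) set" where
  "rel_seminorms X R \<equiv> {p. cstar_seminorm (free_star_algebra X) p \<and> (\<forall>a\<in>R. p a = 0)}"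

lemma zero_rel_seminorm: "(\<lambda>_. 0) \<in> rel_seminorms X R"
  by (simp add: cstar_seminorm_def)

text \<open>Bounded generators bound all words, and hence each element by its coefficients. Thus the
  supremum in \<^const>\<open>universal_seminorm\<close> is a genuine one.\<close>
lemma bdd_above_rel_seminorms:
  assumes gen: "\<And>p g. p \<in> rel_seminorms X R \<Longrightarrow> g \<in> X \<Longrightarrow> p (monomial [(g, False)]) \<le> 1"
    and x: "x \<in> free_star_algebra X"
  shows "bdd_above ((\<lambda>p. p x) ` rel_seminorms X R)"
proof -
  have sn: "cstar_seminormed (free_star_algebra X) p" if "p \<in> rel_seminorms X R" for p
    using that free_star_algebra_star_subalgebra
    by (simp add: cstar_seminormed_def cstar_seminormed_axioms_def)
  have "\<exists>B. \<forall>p\<in>rel_seminorms X R. p x \<le> B"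
    using x
  proof (induction x rule: free_star_algebra_induct)
    case zero
    show ?case
    proof (intro exI ballI)
      show "p 0 \<le> 0" if "p \<in> rel_seminorms X R" for p
        using cstar_seminormed.N_zero[OF sn[OF that]] by simp
    qed
  next
    case (single w c)
    have "p (Poly_Mapping.single w c) \<le> cmod c" if p: "p \<in> rel_seminorms X R" for p
    proof -
      interpret cstar_seminormed "free_star_algebra X" p
        by (rule sn[OF p])
      have "monomial (letters w) \<in> free_star_algebra X"
        using single by (auto simp: monomial_def free_star_algebra_def)
      then have "p (free_scale c (monomial (letters w))) = cmod c * p (monomial (letters w))"
        by (rule N_scale)
      also have "\<dots> \<le> cmod c * 1"
        by (rule mult_left_mono[OF N_monomial_le_1[OF refl gen[OF p] single]]) simp_all
      finally show ?thesis
        by (simp add: monomial_def free_scale_single)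
    qed
    then show ?case
      by blast
  next
    case (add x y)
    then obtain B C where "\<forall>p\<in>rel_seminorms X R. p x \<le> B" "\<forall>p\<in>rel_seminorms X R. p y \<le> C"
      by blast
    then have "p (x + y) \<le> B + C" if "p \<in> rel_seminorms X R" for p
      using cstar_seminormed.N_add[OF sn[OF that] add.hyps] that by fastforce
    then show ?case
      by blast
  qed
  then show ?thesis
    by (auto simp: bdd_above_def)
qed

text \<open>Inequalities pass to the supremum, and so does the C*-identity, since squaring is increasing and
  continuous on nonnegative numbers.\<close>
lemma universal_seminorm_cstar_seminorm:
  assumes gen: "\<And>p g. p \<in> rel_seminorms X R \<Longrightarrow> g \<in> X \<Longrightarrow> p (monomial [(g, False)]) \<le> 1"
  shows "cstar_seminormed (free_star_algebra X) (universal_seminorm X R)"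
proof -
  let ?F = "free_star_algebra X" and ?N = "universal_seminorm X R"
  interpret star_subalgebra ?F
    by (rule free_star_algebra_star_subalgebra)
  have sn: "cstar_seminormed ?F p" if "p \<in> rel_seminorms X R" for p
    using that star_subalgebra_axioms
    by (simp add: cstar_seminormed_def cstar_seminormed_axioms_def)
  have bdd: "bdd_above ((\<lambda>p. p x) ` rel_seminorms X R)" if "x \<in> ?F" for x
    by (rule bdd_above_rel_seminorms[OF _ that]) (rule gen)
  have upper: "p x \<le> ?N x" if "p \<in> rel_seminorms X R" "x \<in> ?F" for p x
    unfolding universal_seminorm_def
    using that(1) bdd[OF that(2)] by (rule cSUP_upper)
  have least: "?N x \<le> B" if "\<And>p. p \<in> rel_seminorms X R \<Longrightarrow> p x \<le> B" for x B
    unfolding universal_seminorm_def using zero_rel_seminorm that by (intro cSUP_least) blast+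
  have ge0: "0 \<le> ?N x" if "x \<in> ?F" for x
    using upper[OF zero_rel_seminorm that] .
  have add: "?N (x + y) \<le> ?N x + ?N y" if "x \<in> ?F" "y \<in> ?F" for x y
  proof (rule least)
    fix p assume p: "p \<in> rel_seminorms X R"
    show "p (x + y) \<le> ?N x + ?N y"
      using cstar_seminormed.N_add[OF sn[OF p] that] upper[OF p that(1)] upper[OF p that(2)] by simp
  qed
  have mult: "?N (x * y) \<le> ?N x * ?N y" if "x \<in> ?F" "y \<in> ?F" for x y
  proof (rule least)
    fix p assume p: "p \<in> rel_seminorms X R"
    have "p x * p y \<le> ?N x * ?N y"
      using that p by (intro mult_mono upper ge0 cstar_seminormed.N_ge_0[OF sn[OF p]])
    then show "p (x * y) \<le> ?N x * ?N y"
      using cstar_seminormed.N_mult[OF sn[OF p] that] by simp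
  qed
  have scale_le: "?N (free_scale c x) \<le> cmod c * ?N x" if "x \<in> ?F" for x c
  proof (rule least)
    fix p assume p: "p \<in> rel_seminorms X R"
    show "p (free_scale c x) \<le> cmod c * ?N x"
      using cstar_seminormed.N_scale[OF sn[OF p] that] upper[OF p that] by (simp add: mult_left_mono)
  qed
  have scale: "?N (free_scale c x) = cmod c * ?N x" if x: "x \<in> ?F" for x c
  proof (cases "c = 0")
    case True
    then show ?thesis
      using scale_le[OF x, of 0] ge0[OF zero_mem] by simp
  next
    case False
    have "?N x \<le> inverse (cmod c) * ?N (free_scale c x)"
      using scale_le[of "free_scale c x" "inverse c"] x False by (simp flip: norm_inverse)
    then have "cmod c * ?N x \<le> ?N (free_scale c x)"
      using False by (simp add: field_simps)
    then show ?thesis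
      using scale_le[OF x, of c] by simp
  qed
  have star: "?N (free_star x * x) = (?N x)\<^sup>2" if x: "x \<in> ?F" for x
  proof (rule antisym)
    show "?N (free_star x * x) \<le> (?N x)\<^sup>2"
    proof (rule least)
      fix p assume p: "p \<in> rel_seminorms X R"
      show "p (free_star x * x) \<le> (?N x)\<^sup>2"
        using cstar_seminormed.N_star_mult[OF sn[OF p] x] upper[OF p x]
          cstar_seminormed.N_ge_0[OF sn[OF p] x] by (simp add: power_mono)
    qed
    have "?N x \<le> sqrt (?N (free_star x * x))"
    proof (rule least)
      fix p assume p: "p \<in> rel_seminorms X R"
      show "p x \<le> sqrt (?N (free_star x * x))"
        using cstar_seminormed.N_star_mult[OF sn[OF p] x] upper[OF p, of "free_star x * x"] x
        by (intro real_le_rsqrt) simp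
    qed
    then show "(?N x)\<^sup>2 \<le> ?N (free_star x * x)"
      using ge0[OF x] ge0[of "free_star x * x"] x by (metis mult_mem power_mono real_sqrt_pow2 star_mem)
  qed
  show ?thesis
    using star_subalgebra_axioms ge0 add mult scale star
    by (simp add: cstar_seminormed_def cstar_seminormed_axioms_def cstar_seminorm_def)
qed

lemma universal_seminorm_relation:
  assumes "a \<in> R"
  shows "universal_seminorm X R a = 0"
proof -
  have "(\<lambda>p. p a) ` rel_seminorms X R = {0}"
    using assms zero_rel_seminorm[of X R] by auto
  then show ?thesis
    by (simp add: universal_seminorm_def)
qed

section \<open>The graph algebra\<close>

lemma fP_mem: "v \<in> verts E \<Longrightarrow> fP v \<in> free_star_algebra (graph_gens E)"
  and fS_mem: "e \<in> arcs E \<Longrightarrow> fS e \<in> free_star_algebra (graph_gens E)"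
  by (auto simp: fP_def fS_def monomial_def free_star_algebra_def graph_gens_def)

text \<open>By the C*-identity, \<open>p (P\<^sub>v)\<^sup>2 = p (P\<^sub>v)\<close> and \<open>p (S\<^sub>e)\<^sup>2 = p (S\<^sub>e\<^sup>\<star> S\<^sub>e) = p (P\<^sub>v)\<close> for the head
  \<open>v\<close> of \<open>e\<close>.\<close>
lemma (in wf_digraph) generator_seminorm_le_1:
  assumes p: "p \<in> rel_seminorms (graph_gens G) (graph_relations G)" and g: "g \<in> graph_gens G"
  shows "p (monomial [(g, False)]) \<le> 1"
proof -
  let ?F = "free_star_algebra (graph_gens G)"
  interpret cstar_seminormed ?F p
    using p free_star_algebra_star_subalgebra
    by (simp add: cstar_seminormed_def cstar_seminormed_axioms_def)
  have eqI: "p x = p y" if "x - y \<in> graph_relations G" "x \<in> ?F" "y \<in> ?F" for x y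
    using N_abs_diff[OF that(2,3)] p that(1) by auto
  have P: "p (fP v) \<le> 1" if v: "v \<in> verts G" for v
  proof -
    note [simp] = fP_mem[OF v]
    have rel: "free_star (fP v) - fP v \<in> graph_relations G" "fP v * fP v - fP v \<in> graph_relations G"
      using v by (auto simp: graph_relations_def)
    have "p (free_star (fP v) * fP v - fP v * fP v) = p ((free_star (fP v) - fP v) * fP v)"
      by (simp add: left_diff_distrib)
    also have "\<dots> \<le> p (free_star (fP v) - fP v) * p (fP v)"
      by (rule N_mult) simp_all
    also have "\<dots> = 0"
      using p rel by simp
    finally have "p (free_star (fP v) * fP v - fP v * fP v) \<le> 0" .
    then have "p (free_star (fP v) * fP v) = p (fP v * fP v)"
      using N_abs_diff[of "free_star (fP v) * fP v" "fP v * fP v"] by simp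
    also have "\<dots> = p (fP v)"
      by (rule eqI[OF rel(2)]) simp_all
    finally have "p (fP v) * p (fP v) \<le> 1 * p (fP v)"
      by (auto simp: N_star_mult power2_eq_square)
    then show ?thesis
      by (rule le_if_square_le_mult) simp_all
  qed
  have S: "p (fS e) \<le> 1" if e: "e \<in> arcs G" for e
  proof -
    note [simp] = fS_mem[OF e] fP_mem[OF head_in_verts[OF e]]
    have "free_star (fS e) * fS e - fP (head G e) \<in> graph_relations G"
      using e by (auto simp: graph_relations_def)
    then have "p (free_star (fS e) * fS e) = p (fP (head G e))"
      by (rule eqI) simp_all
    then have "(p (fS e))\<^sup>2 \<le> 1\<^sup>2"
      using P[OF head_in_verts[OF e]] by (simp add: N_star_mult)
    then show ?thesis
      by (rule power2_le_imp_le) simp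
  qed
  show ?thesis
    using g P S by (auto simp: graph_gens_def fP_def fS_def)
qed

context wf_digraph
begin

abbreviation free_embed :: "('a, 'b) generator free_alg \<Rightarrow> (nat \<Rightarrow> ('a, 'b) generator free_alg) set" where
  "free_embed \<equiv> universal_embed (graph_gens G) (graph_relations G)"

lemma graph_cstar_seminormed:
  "cstar_seminormed (free_star_algebra (graph_gens G)) (universal_seminorm (graph_gens G) (graph_relations G))"
  by (rule universal_seminorm_cstar_seminorm) (rule generator_seminorm_le_1)

sublocale graph_norm: cstar_seminormed "free_star_algebra (graph_gens G)"
  "universal_seminorm (graph_gens G) (graph_relations G)"
  by (rule graph_cstar_seminormed)

lemma graph_cstar_completion: "graph_cstar G = graph_norm.completed"
  by (simp add: graph_cstar_def universal_cstar_def)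

lemma free_embed_cls: "free_embed x = graph_norm.cls (\<lambda>_. x)"
  by (simp add: universal_embed_def)

lemma free_embed_closed: "x \<in> free_star_algebra (graph_gens G) \<Longrightarrow> free_embed x \<in> carrier (graph_cstar G)"
  by (simp add: graph_cstar_completion free_embed_cls)

lemma free_embed_mult:
  "x \<in> free_star_algebra (graph_gens G) \<Longrightarrow> y \<in> free_star_algebra (graph_gens G) \<Longrightarrow>
    smult (graph_cstar G) (free_embed x) (free_embed y) = free_embed (x * y)"
  by (simp add: graph_cstar_completion free_embed_cls)

lemma free_embed_star:
  "x \<in> free_star_algebra (graph_gens G) \<Longrightarrow> sstar (graph_cstar G) (free_embed x) = free_embed (free_star x)"
  by (simp add: graph_cstar_completion free_embed_cls)

lemma free_embed_zero: "szero (graph_cstar G) = free_embed 0"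
  by (simp add: graph_cstar_completion free_embed_cls graph_norm.szero_completion)

lemma free_embed_eqI:
  assumes "x - y \<in> graph_relations G"
    and "x \<in> free_star_algebra (graph_gens G)" "y \<in> free_star_algebra (graph_gens G)"
  shows "free_embed x = free_embed y"
  using assms universal_seminorm_relation[OF assms(1)]
  by (simp add: free_embed_cls graph_norm.cls_eq_iff)

lemma graph_cstar_family: "graph_family (graph_cstar G) G (\<lambda>v. free_embed (fP v)) (\<lambda>e. free_embed (fS e))"
proof -
  interpret cstar_algebra "graph_cstar G"
    unfolding graph_cstar_completion by (rule graph_norm.completion_cstar_algebra)
  note mem = fP_mem fS_mem
  show ?thesis
  proof
    fix v assume v: "v \<in> verts G"
    have "free_embed (free_star (fP v)) = free_embed (fP v)" "free_embed (fP v * fP v) = free_embed (fP v)"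
      using v by (intro free_embed_eqI; auto simp: graph_relations_def mem)+
    then show "is_proj (free_embed (fP v))"
      using v by (simp add: is_proj_def free_embed_mult free_embed_star free_embed_closed mem)
    fix w assume "w \<in> verts G" "v \<noteq> w"
    then have "free_embed (fP v * fP w) = free_embed 0"
      using v by (intro free_embed_eqI) (auto simp: graph_relations_def mem)
    then show "smult (graph_cstar G) (free_embed (fP v)) (free_embed (fP w)) = szero (graph_cstar G)"
      using v \<open>w \<in> verts G\<close> by (simp add: free_embed_mult free_embed_star free_embed_closed free_embed_zero mem)
  next
    fix e assume e: "e \<in> arcs G"
    show "free_embed (fS e) \<in> carrier (graph_cstar G)"
      using e by (simp add: free_embed_mult free_embed_star free_embed_closed mem)
    have "free_embed (free_star (fS e) * fS e) = free_embed (fP (head G e))"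
      using e by (intro free_embed_eqI) (auto simp: graph_relations_def mem)
    then show "smult (graph_cstar G) (sstar (graph_cstar G) (free_embed (fS e))) (free_embed (fS e)) = free_embed (fP (head G e))"
      using e by (simp add: free_embed_mult free_embed_star free_embed_closed mem)
    have "free_embed (fP (tail G e) * (fS e * free_star (fS e))) = free_embed (fS e * free_star (fS e))"
      using e by (intro free_embed_eqI) (auto simp: graph_relations_def mem)
    then show "smult (graph_cstar G) (free_embed (fP (tail G e)))
        (smult (graph_cstar G) (free_embed (fS e)) (sstar (graph_cstar G) (free_embed (fS e)))) =
        smult (graph_cstar G) (free_embed (fS e)) (sstar (graph_cstar G) (free_embed (fS e)))"
      using e by (simp add: free_embed_mult free_embed_star free_embed_closed mem)
    fix f assume f: "f \<in> arcs G" "e \<noteq> f"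
    then have "free_embed (free_star (fS e) * fS f) = free_embed 0"
      using e by (intro free_embed_eqI) (auto simp: graph_relations_def mem)
    then show "smult (graph_cstar G) (sstar (graph_cstar G) (free_embed (fS e))) (free_embed (fS f)) = szero (graph_cstar G)"
      using e f by (simp add: free_embed_mult free_embed_star free_embed_closed free_embed_zero mem)
  qed
qed

sublocale graph_alg: graph_family "graph_cstar G" G "\<lambda>v. free_embed (fP v)" "\<lambda>e. free_embed (fS e)"
  by (rule graph_cstar_family)

lemma free_embed_path:
  assumes "awalk u \<mu> v" "\<mu> \<noteq> []"
  shows "free_embed (monomial (map (\<lambda>e. (GE e, False)) \<mu>)) = graph_alg.path_elem u \<mu>"
  using assms(2,1)
proof (induction \<mu> arbitrary: u rule: list_nonempty_induct)
  case (single e)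
  have "(monomial (map (\<lambda>e. (GE e, False)) [e]) :: ('a, 'b) generator free_alg) = fS e"
    by (simp add: fS_def)
  then show ?case
    using single graph_alg.S_head[of e] by (simp add: graph_alg.awalk_Cons_iff')
next
  case (cons e \<mu>)
  have e: "e \<in> arcs G" and \<mu>: "awalk (head G e) \<mu> v"
    using cons.prems by (auto simp: graph_alg.awalk_Cons_iff')
  have "(monomial (map (\<lambda>e. (GE e, False)) (e # \<mu>)) :: ('a, 'b) generator free_alg) =
      fS e * monomial (map (\<lambda>e. (GE e, False)) \<mu>)"
    using monomial_append[of "[(GE e, False)]" "map (\<lambda>e. (GE e, False)) \<mu>"] by (simp add: fS_def)
  moreover have "(monomial (map (\<lambda>e. (GE e, False)) \<mu>) :: ('a, 'b) generator free_alg) \<in> free_star_algebra (graph_gens G)"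
    using \<mu> cons.hyps by (auto simp: monomial_def free_star_algebra_def graph_gens_def awalk_def)
  ultimately show ?case
    using cons.IH[OF \<mu>] e by (simp add: fS_mem flip: free_embed_mult)
qed

lemma path_elements_eq: "path_elements G = {graph_alg.path_elem u \<mu> | u \<mu> v. awalk u \<mu> v}"
proof (intro equalityI subsetI)
  fix s assume "s \<in> path_elements G"
  then consider v where "v \<in> verts G" "s = free_embed (fP v)"
    | u \<mu> v where "awalk u \<mu> v" "\<mu> \<noteq> []" "s = free_embed (monomial (map (\<lambda>e. (GE e, False)) \<mu>))"
    unfolding path_elements_def by blast
  then show "s \<in> {graph_alg.path_elem u \<mu> | u \<mu> v. awalk u \<mu> v}"
  proof cases
    case 1
    then have "s = graph_alg.path_elem v []" "awalk v [] v"
      by (simp_all add: awalk_def)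
    then show ?thesis
      by blast
  next
    case 2
    then show ?thesis
      using free_embed_path by blast
  qed
next
  fix s assume "s \<in> {graph_alg.path_elem u \<mu> | u \<mu> v. awalk u \<mu> v}"
  then obtain u \<mu> v where w: "awalk u \<mu> v" and s: "s = graph_alg.path_elem u \<mu>"
    by blast
  show "s \<in> path_elements G"
  proof (cases "\<mu> = []")
    case True
    then show ?thesis
      using w s by (auto simp: path_elements_def awalk_def)
  next
    case False
    then show ?thesis
      using w s free_embed_path[OF w] by (auto simp: path_elements_def)
  qed
qed

lemma diagonal_eq: "diagonal G = cstar_generated (graph_cstar G) {graph_alg.path_proj u \<mu> | u \<mu> v. awalk u \<mu> v}"
proof -
  have "{smult (graph_cstar G) s (sstar (graph_cstar G) s) | s. s \<in> path_elements G} =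
      {graph_alg.path_proj u \<mu> | u \<mu> v. awalk u \<mu> v}"
    unfolding path_elements_eq graph_alg.path_proj_def by blast
  then show ?thesis
    by (simp add: diagonal_def)
qed

lemma path_projs_subset: "{graph_alg.path_proj u \<mu> | u \<mu> v. awalk u \<mu> v} \<subseteq> carrier (graph_cstar G)"
  using graph_alg.path_proj_closed by blast

lemma path_proj_in_diagonal: "awalk u \<mu> v \<Longrightarrow> graph_alg.path_proj u \<mu> \<in> diagonal G"
  unfolding diagonal_eq by (rule subsetD[OF graph_alg.subset_generated]) blast

lemma diagonal_subset: "diagonal G \<subseteq> carrier (graph_cstar G)"
  unfolding diagonal_eq
  by (rule graph_alg.generated_subset[OF graph_alg.carrier_subalgebra path_projs_subset])

lemma diagonal_commute:
  assumes "d \<in> diagonal G" "d' \<in> diagonal G"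
  shows "smult (graph_cstar G) d d' = smult (graph_cstar G) d' d"
proof (rule graph_alg.generated_commute[OF path_projs_subset _ _ assms[unfolded diagonal_eq]])
  fix x assume x: "x \<in> {graph_alg.path_proj u \<mu> | u \<mu> v. awalk u \<mu> v}"
  then obtain u \<mu> v where x': "x = graph_alg.path_proj u \<mu>" "awalk u \<mu> v"
    by blast
  then show "sstar (graph_cstar G) x \<in> {graph_alg.path_proj u \<mu> | u \<mu> v. awalk u \<mu> v}"
    using x graph_alg.is_projD(2)[OF graph_alg.path_proj_is_proj[OF x'(2)]] by simp
  fix y assume "y \<in> {graph_alg.path_proj u \<mu> | u \<mu> v. awalk u \<mu> v}"
  then obtain u' \<mu>' v' where "y = graph_alg.path_proj u' \<mu>'" "awalk u' \<mu>' v'"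
    by blast
  then show "smult (graph_cstar G) x y = smult (graph_cstar G) y x"
    using x' graph_alg.path_projs_commute by simp
qed

text \<open>Both automorphisms map the diagonal into itself, so the two images of a path projection commute.
  Agreement on the path projections extends to the diagonal by continuity.\<close>
lemma close_autos_agree_on_diagonal:
  assumes f: "f \<in> star_auto (graph_cstar G)" "f ` diagonal G = diagonal G"
    and g: "g \<in> star_auto (graph_cstar G)" "g ` diagonal G = diagonal G"
    and close: "\<And>x. x \<in> graph_gens G \<Longrightarrow>
      sdist (graph_cstar G) (f (free_embed (monomial [(x, False)]))) (g (free_embed (monomial [(x, False)]))) < 1/2"
    and d: "d \<in> diagonal G"
  shows "f d = g d"
proof -
  have endo: "graph_alg.star_endo h" if "h \<in> star_auto (graph_cstar G)" for h
    using that Bij_imp_funcset by (fastforce simp: star_auto_def graph_alg.star_endo_def)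
  have "f (graph_alg.path_proj u \<mu>) = g (graph_alg.path_proj u \<mu>)" if "awalk u \<mu> v" for u \<mu> v
  proof (rule graph_alg.close_star_endos_agree[OF endo[OF f(1)] endo[OF g(1)]])
    show "snorm (graph_cstar G) (sminus (graph_cstar G) (f (free_embed (fP v))) (g (free_embed (fP v)))) < 1"
      if "v \<in> verts G" for v
      using close[of "GV v"] that by (simp add: graph_gens_def fP_def sdist_def)
    show "snorm (graph_cstar G) (sminus (graph_cstar G) (f (free_embed (fS e))) (g (free_embed (fS e)))) < 1/2"
      if "e \<in> arcs G" for e
      using close[of "GE e"] that by (simp add: graph_gens_def fS_def sdist_def)
    show "f (graph_alg.path_proj u \<mu>) \<in> diagonal G" "g (graph_alg.path_proj u \<mu>) \<in> diagonal G"
      if "awalk u \<mu> v" for u \<mu> v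
      using f(2) g(2) path_proj_in_diagonal[OF that] by blast+
    show "smult (graph_cstar G) d d' = smult (graph_cstar G) d' d" if "d \<in> diagonal G" "d' \<in> diagonal G" for d d'
      using that by (rule diagonal_commute)
  qed (rule that)
  then show ?thesis
    using d unfolding diagonal_eq
    by (intro graph_alg.star_endos_eq_on_generated[OF endo[OF f(1)] endo[OF g(1)] path_projs_subset _ d[unfolded diagonal_eq]]) blast
qed

end


section \<open>Countability of the Weyl group\<close>

lemma countable_image_if_factors:
  assumes "countable (\<Phi> ` B)" and "\<And>a b. a \<in> B \<Longrightarrow> b \<in> B \<Longrightarrow> \<Phi> a = \<Phi> b \<Longrightarrow> F a = F b"
  shows "countable (F ` B)"
proof -
  define pick where "pick c = (SOME a. a \<in> B \<and> \<Phi> a = c)" for c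
  have "F a = F (pick (\<Phi> a))" if "a \<in> B" for a
  proof -
    have "pick (\<Phi> a) \<in> B \<and> \<Phi> (pick (\<Phi> a)) = \<Phi> a"
      unfolding pick_def by (rule someI[of _ a]) (simp add: that)
    then show ?thesis
      using assms(2)[OF that] by metis
  qed
  then have "F ` B \<subseteq> (\<lambda>c. F (pick c)) ` \<Phi> ` B"
    by blast
  then show ?thesis
    using assms(1) by (meson countable_image countable_subset)
qed

theorem proposition3p5:
  fixes E :: "('v, 'e) pre_digraph"
  assumes "fin_digraph E"
  shows "countable (carrier (weyl_group E))"
proof -
  interpret fin_digraph E
    by (rule assms)
  let ?A = "graph_cstar E" and ?D = "diagonal E"
  let ?Aut = "carrier (Aut_preserving ?A ?D)"
  have Aut: "?Aut = {f \<in> star_auto ?A. f ` ?D = ?D}"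
    by (simp add: Aut_preserving_def)
  have "finite (graph_gens E)"
    by (simp add: graph_gens_def)
  then obtain gs where gs: "set gs = graph_gens E"
    using finite_list by blast
  \<comment> \<open>A countable dense set: each automorphism is recorded, on generators, up to an error of
    \<open>1/4\<close>, so two automorphisms with the same record differ by less than \<open>1/2\<close> there.\<close>
  obtain C where C: "countable C" "C \<subseteq> free_star_algebra (graph_gens E)"
    and dense: "\<And>N x e. cstar_seminorm (free_star_algebra (graph_gens E)) N \<Longrightarrow>
      x \<in> free_star_algebra (graph_gens E) \<Longrightarrow> e > 0 \<Longrightarrow> \<exists>c\<in>C. N (x - c) < e"
    using countable_dense_free_star_algebra[of "graph_gens E"] \<open>finite (graph_gens E)\<close>
    by (metis countable_finite)
  \<comment> \<open>The error splits evenly: half for replacing an element of the completion by one of the free algebra,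
    half for moving that one into \<open>C\<close>.\<close>
  have approx: "\<exists>c\<in>C. sdist ?A a (free_embed c) < 1/4" if a: "a \<in> carrier ?A" for a
  proof -
    obtain x where x: "x \<in> free_star_algebra (graph_gens E)" "sdist ?A a (free_embed x) < 1/8"
      using graph_norm.completion_dense[of a "1/8"] a by (auto simp: graph_cstar_completion free_embed_cls)
    obtain c where c: "c \<in> C" "universal_seminorm (graph_gens E) (graph_relations E) (x - c) < 1/8"
      using dense[OF graph_norm.seminorm x(1), of "1/8"] by auto
    have cF: "c \<in> free_star_algebra (graph_gens E)"
      using c C by blast
    have "sdist ?A (free_embed x) (free_embed c) < 1/8"
      using c x cF by (simp add: graph_cstar_completion free_embed_cls)
    then have "sdist ?A a (free_embed c) < 1/4"
      using x graph_alg.norm_minus_triangle[of a "free_embed x" "free_embed c"] a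
        free_embed_closed[OF x(1)] free_embed_closed[OF cF] by (simp add: sdist_def)
    then show ?thesis
      using c by blast
  qed
  define near where "near a = (SOME c. c \<in> C \<and> sdist ?A a (free_embed c) < 1/4)" for a
  have near: "near a \<in> C" "sdist ?A a (free_embed (near a)) < 1/4" if "a \<in> carrier ?A" for a
    using someI_ex[of "\<lambda>c. c \<in> C \<and> sdist ?A a (free_embed c) < 1/4"] approx[OF that]
    unfolding near_def by blast+
  define gen where "gen x = free_embed (monomial [(x, False)])" for x
  have gen: "gen x \<in> carrier ?A" if "x \<in> graph_gens E" for x
    using that unfolding gen_def by (intro free_embed_closed) (auto simp: monomial_def free_star_algebra_def)
  define \<Phi> where "\<Phi> f = map (\<lambda>x. near (f (gen x))) gs" for f
  have "\<Phi> ` ?Aut \<subseteq> lists C"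
    using gs gen near(1) graph_alg.star_autoD(2) by (auto simp: \<Phi>_def Aut)
  then have count: "countable (\<Phi> ` ?Aut)"
    using C(1) by (meson countable_lists countable_subset)
  have cosets: "Aut_fixing ?A ?D #>\<^bsub>Aut_preserving ?A ?D\<^esub> f = Aut_fixing ?A ?D #>\<^bsub>Aut_preserving ?A ?D\<^esub> g"
    if f: "f \<in> ?Aut" and g: "g \<in> ?Aut" and eq: "\<Phi> f = \<Phi> g" for f g
  proof (rule graph_alg.Aut_fixing_coset_eq[OF diagonal_subset])
    show fg: "f \<in> star_auto ?A" "g \<in> star_auto ?A" "g ` ?D = ?D"
      using f g by (auto simp: Aut)
    have "f ` ?D = ?D"
      using f by (simp add: Aut)
    moreover have "sdist ?A (f (gen x)) (g (gen x)) < 1/2" if x: "x \<in> graph_gens E" for x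
    proof -
      let ?c = "near (f (gen x))"
      have c: "?c = near (g (gen x))"
        using eq x gs by (simp add: \<Phi>_def)
      have car: "f (gen x) \<in> carrier ?A" "g (gen x) \<in> carrier ?A"
        using gen[OF x] graph_alg.star_autoD(2) fg by auto
      have cF: "?c \<in> free_star_algebra (graph_gens E)"
        using near(1)[OF car(1)] C by blast
      note cc = free_embed_closed[OF cF]
      show ?thesis
        using graph_alg.norm_minus_triangle[OF car(1) cc car(2)] graph_alg.norm_minus_commute[OF cc car(2)]
          near(2)[OF car(1)] near(2)[OF car(2)] unfolding sdist_def c by linarith
    qed
    ultimately show "f d = g d" if "d \<in> ?D" for d
      using close_autos_agree_on_diagonal[OF fg(1) _ fg(2,3) _ that] by (simp add: gen_def)
  qed
  have "countable ((\<lambda>f. Aut_fixing ?A ?D #>\<^bsub>Aut_preserving ?A ?D\<^esub> f) ` ?Aut)"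
    by (rule countable_image_if_factors[OF count cosets])
  then show ?thesis
    by (simp add: weyl_group_def carrier_FactGroup)
qed

end
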